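(* Let $g$ be a positive integer, let $z=(z_1,\dots,z_{2g+1})$ be pairwise distinct complex numbers and $\lambda\in\mathbb C^\times$. Let $$\Phi(t,z,\lambda)=e^{\lambda t}\prod_{i=1}^{2g+1}(t-z_i)^{-1/2},$$ let $\delta$ be a 1-cycle (in the twisted sense of the context), and let $$I_i(z,\lambda)=\int_\delta \Phi(t,z,\lambda)\,\frac{dt}{t-z_i},\qquad i=1,\dots,2g+1.$$ Then the tuple $I=(I_1,\dots,I_{2g+1})$ satisfies the system $$\frac{\partial I_j}{\partial z_i}=\frac12\,\frac{I_i-I_j}{z_i-z_j}\quad (i\ne j),$$ $$\frac{\partial I_i}{\partial z_i}=\lambda I_i-\frac12\sum_{j\ne i}\frac{I_i-I_j}{z_i-z_j},$$ $$\frac{\partial I_i}{\partial\lambda}=z_iI_i+\frac1{2\lambda}\sum_{j=1}^{2g+1}I_j,$$ for all $i,j\in\{1,\dots,2g+1\}$.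
   Context: A twisted 1-cycle for $\Phi$ at a base point $(z^0,\lambda^0)$ is a finite $\mathbb C$-linear combination of piecewise smooth oriented paths in the $t$-plane avoiding $z^0_1,\dots,z^0_{2g+1}$, each equipped with a continuous branch of the multivalued function $\Phi(\cdot,z^0,\lambda^0)$ along it. Each path is either compact or has ends which, outside a compact set, are rays going to infinity in directions along which $\mathrm{Re}(\lambda^0 t)\to-\infty$. The twisted boundary (the combination of finite endpoints, counted with the coefficients and branches) is required to be zero; the simplest example is a closed loop along which a branch of $\Phi$ returns to itself. For $(z,\lambda)$ near $(z^0,\lambda^0)$ the same paths are used, with the branches of $\Phi$ continued analytically in $(z,\lambda)$ (the cycle is locally constant in the parameters), so that $I_i(z,\lambda)$ are holomorphic functions near $(z^0,\lambda^0)$; the equations are asserted there. *)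

theory Defs
  imports "HOL-Analysis.Analysis"
begin

type_synonym 'n params = "(complex ^ 'n) \<times> complex"

definition parameter_space :: "'n::finite params set" where
  "parameter_space = {(z, l). (\<forall>i j. i \<noteq> j \<longrightarrow> z $ i \<noteq> z $ j) \<and> l \<noteq> 0}"

text \<open>
  All values at \<open>t\<close> of the multivalued function
  \<open>\<Phi>(t,z,l) = exp(l t) \<Prod>i. (t - z\<^sub>i)\<^sup>-\<^sup>1\<^sup>/\<^sup>2\<close>: each factor \<open>r i\<close> is a square root of
  \<open>1 / (t - z\<^sub>i)\<close>. The set is empty if \<open>t\<close> is one of the \<open>z\<^sub>i\<close>.
\<close>
definition Phi_values :: "'n::finite params \<Rightarrow> complex \<Rightarrow> complex set" where
  "Phi_values p t =
     {exp (snd p * t) * (\<Prod>i\<in>UNIV. r i) | r. \<forall>i. (r i)\<^sup>2 * (t - fst p $ i) = 1}"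

definition Phi_branch_along ::
    "'n::finite params \<Rightarrow> real set \<Rightarrow> (real \<Rightarrow> complex) \<Rightarrow> (real \<Rightarrow> complex) \<Rightarrow> bool" where
  "Phi_branch_along p J \<gamma> \<phi> \<longleftrightarrow>
     continuous_on J \<phi> \<and> (\<forall>s\<in>J. \<phi> s \<in> Phi_values p (\<gamma> s))"

text \<open>
  The textbook notion: \<open>C\<^sup>1\<close> up to the end points (with one-sided derivatives there) on every
  closed interval between consecutive break points. The library's
  \<open>piecewise_C1_differentiable_on\<close> would also admit derivatives that blow up at the
  break points.
\<close>
definition piecewise_smooth_on :: "(real \<Rightarrow> complex) \<Rightarrow> real set \<Rightarrow> bool" where
  "piecewise_smooth_on \<gamma> J \<longleftrightarrow>
     continuous_on J \<gamma> \<and>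
     (\<exists>P. finite P \<and>
        (\<forall>a b. a < b \<and> {a..b} \<subseteq> J \<and> {a<..<b} \<inter> P = {} \<longrightarrow>
           (\<exists>D. continuous_on {a..b} D \<and>
                (\<forall>s\<in>{a..b}. (\<gamma> has_vector_derivative D s) (at s within {a..b})))))"

text \<open>
  A path is parametrized by a closed interval \<open>J\<close>, which is compact, a closed half-line, or the
  whole line. An unbounded end of \<open>J\<close> corresponds to an end of the path at infinity; near it the
  path is an affinely parametrized ray, whose direction \<open>v\<close> points towards infinity.
\<close>
definition admissible_path ::
    "'n::finite params \<Rightarrow> real set \<Rightarrow> (real \<Rightarrow> complex) \<Rightarrow> bool" where
  "admissible_path p J \<gamma> \<longleftrightarrow>
     is_interval J \<and> closed J \<and> J \<noteq> {} \<and>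
     piecewise_smooth_on \<gamma> J \<and>
     (\<forall>s\<in>J. \<forall>i. \<gamma> s \<noteq> fst p $ i) \<and>
     (\<not> bdd_above J \<longrightarrow>
        (\<exists>T v. Re (snd p * v) < 0 \<and> T \<in> J \<and>
               (\<forall>s\<ge>T. \<gamma> s = \<gamma> T + of_real (s - T) * v))) \<and>
     (\<not> bdd_below J \<longrightarrow>
        (\<exists>T v. Re (snd p * v) < 0 \<and> T \<in> J \<and>
               (\<forall>s\<le>T. \<gamma> s = \<gamma> T + of_real (T - s) * v)))"

text \<open>
  A twisted chain consists of paths \<open>\<gamma> k\<close> on \<open>J k\<close> with branches \<open>\<phi> k\<close> and coefficients
  \<open>c k\<close>, for \<open>k < m\<close>. A branch of \<open>\<Phi>\<close> near a point \<open>t\<close> is determined by its (nonzero) value at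
  \<open>t\<close>, and the local branches at \<open>t\<close> span a one-dimensional space over the complex numbers
  (the branch with the opposite sign is \<open>-1\<close> times the branch). The part of the boundary
  supported at \<open>t\<close> is therefore a complex number: the final minus the initial end points
  lying at \<open>t\<close>, weighted with coefficient times branch value.
\<close>
definition twisted_boundary ::
    "nat \<Rightarrow> (nat \<Rightarrow> complex) \<Rightarrow> (nat \<Rightarrow> real set) \<Rightarrow> (nat \<Rightarrow> real \<Rightarrow> complex) \<Rightarrow>
     (nat \<Rightarrow> real \<Rightarrow> complex) \<Rightarrow> complex \<Rightarrow> complex" where
  "twisted_boundary m c J \<gamma> \<phi> t =
     (\<Sum>k | k < m \<and> bdd_above (J k) \<and> \<gamma> k (Sup (J k)) = t. c k * \<phi> k (Sup (J k))) -
     (\<Sum>k | k < m \<and> bdd_below (J k) \<and> \<gamma> k (Inf (J k)) = t. c k * \<phi> k (Inf (J k)))"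

definition twisted_cycle ::
    "'n::finite params \<Rightarrow> nat \<Rightarrow> (nat \<Rightarrow> complex) \<Rightarrow> (nat \<Rightarrow> real set) \<Rightarrow>
     (nat \<Rightarrow> real \<Rightarrow> complex) \<Rightarrow> (nat \<Rightarrow> real \<Rightarrow> complex) \<Rightarrow> bool" where
  "twisted_cycle p m c J \<gamma> \<phi> \<longleftrightarrow>
     (\<forall>k<m. admissible_path p (J k) (\<gamma> k) \<and> Phi_branch_along p (J k) (\<gamma> k) (\<phi> k)) \<and>
     (\<forall>t. twisted_boundary m c J \<gamma> \<phi> t = 0)"

text \<open>Holomorphy in all variables jointly: the real derivative exists and is complex linear.\<close>
definition jointly_holomorphic_on ::
    "('n::finite params \<Rightarrow> complex) \<Rightarrow> 'n params set \<Rightarrow> bool" where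
  "jointly_holomorphic_on f U \<longleftrightarrow>
     (\<forall>p\<in>U. \<exists>L. (f has_derivative L) (at p) \<and>
        (\<forall>a v w. L (a *s v, a * w) = a * L (v, w)))"

text \<open>
  The branches \<open>\<phi> k\<close> given at \<open>p0\<close> are continued analytically over \<open>U\<close> along the same paths.
  If \<open>U\<close> is connected and contains \<open>p0\<close>, the continuation is unique on the intervals \<open>J k\<close>.
\<close>
definition branch_continuation ::
    "'n::finite params set \<Rightarrow> 'n params \<Rightarrow> nat \<Rightarrow> (nat \<Rightarrow> real set) \<Rightarrow>
     (nat \<Rightarrow> real \<Rightarrow> complex) \<Rightarrow> (nat \<Rightarrow> real \<Rightarrow> complex) \<Rightarrow>
     ('n params \<Rightarrow> nat \<Rightarrow> real \<Rightarrow> complex) \<Rightarrow> bool" where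
  "branch_continuation U p0 m J \<gamma> \<phi> \<Psi> \<longleftrightarrow>
     (\<forall>k<m.
        (\<forall>s\<in>J k. \<Psi> p0 k s = \<phi> k s) \<and>
        (\<forall>p\<in>U. Phi_branch_along p (J k) (\<gamma> k) (\<Psi> p k)) \<and>
        (\<forall>s\<in>J k. jointly_holomorphic_on (\<lambda>p. \<Psi> p k s) U))"

text \<open>
  The pull-back of \<open>\<Phi> dt / (t - z\<^sub>i)\<close> to the parameter interval. The library's contour integral
  does not apply, since a branch is a function of the parameter \<open>s\<close>, not of \<open>\<gamma> s\<close>.
\<close>
definition pulled_back_form ::
    "'n::finite params \<Rightarrow> (real \<Rightarrow> complex) \<Rightarrow> (real \<Rightarrow> complex) \<Rightarrow> 'n \<Rightarrow> real \<Rightarrow> complex" where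
  "pulled_back_form p \<gamma> \<phi> i s =
     \<phi> s / (\<gamma> s - fst p $ i) * vector_derivative \<gamma> (at s)"

definition twisted_integral ::
    "nat \<Rightarrow> (nat \<Rightarrow> complex) \<Rightarrow> (nat \<Rightarrow> real set) \<Rightarrow> (nat \<Rightarrow> real \<Rightarrow> complex) \<Rightarrow>
     ('n::finite params \<Rightarrow> nat \<Rightarrow> real \<Rightarrow> complex) \<Rightarrow> 'n \<Rightarrow> 'n params \<Rightarrow> complex" where
  "twisted_integral m c J \<gamma> \<Psi> i p =
     (\<Sum>k<m. c k * integral (J k) (pulled_back_form p (\<gamma> k) (\<Psi> p k) i))"

definition set_coord :: "complex ^ 'n \<Rightarrow> 'n::finite \<Rightarrow> complex \<Rightarrow> complex ^ 'n" where
  "set_coord z i w = (\<chi> j. if j = i then w else z $ j)"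

definition has_partial_z ::
    "('n::finite params \<Rightarrow> complex) \<Rightarrow> 'n \<Rightarrow> complex \<Rightarrow> 'n params \<Rightarrow> bool" where
  "has_partial_z f i D p \<longleftrightarrow>
     ((\<lambda>w. f (set_coord (fst p) i w, snd p)) has_field_derivative D) (at (fst p $ i))"

definition has_partial_lambda ::
    "('n::finite params \<Rightarrow> complex) \<Rightarrow> complex \<Rightarrow> 'n params \<Rightarrow> bool" where
  "has_partial_lambda f D p \<longleftrightarrow>
     ((\<lambda>w. f (fst p, w)) has_field_derivative D) (at (snd p))"

end

theory Submission
  imports Defs
begin

text \<open>
  Squaring a branch \<open>\<psi>\<close> of \<open>\<Phi>\<close> makes it single-valued, so \<open>\<psi>\<close> inherits derivatives from
  \<open>\<psi>\<^sup>2 = exp (2 l t) \<Prod>i. 1 / (t - z\<^sub>i)\<close>, both along a path and in the parameters: its logarithmic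
  differential is \<open>l dt + t dl - 1/2 \<Sum>i. (dt - dz\<^sub>i) / (t - z\<^sub>i)\<close>. Near the base point the
  integrands and their parameter derivatives are bounded by a multiple of \<open>exp (- \<eta> |s|)\<close>, which
  justifies differentiation under the integral sign. Analytic continuation multiplies all branches
  at a point \<open>t\<close> by the same number, hence the twisted boundary stays zero and the integrals of the
  exact forms \<open>d\<Phi>\<close> and \<open>d(\<Phi> / (t - z\<^sub>i))\<close> vanish. Together with the partial fraction decomposition
  of \<open>1 / ((t - z\<^sub>i) (t - z\<^sub>j))\<close> these relations turn the differentiated integrals into the
  right-hand sides of the system.
\<close>

section \<open>Integrals of exponentially decaying functions\<close>

text \<open>The neighbourhood \<open>U\<close> has to be fixed before any continuation is given, and
  the claim then concerns all of them. It is a ball so small that \<open>z i\<close> moves by less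
  than the distance from \<open>z0 i\<close> to every point \<open>t\<close> of the paths. Then
  \<open>(t - z i) / (t - z0 i)\<close> has positive real part, and the inverse principal roots,
  times an exponential, continue every branch explicitly. This multiplier depends on
  \<open>t\<close> and the parameters alone, neither on the path nor on the branch, so end points
  lying at the same \<open>t\<close> go on cancelling. Connectedness of the ball identifies every
  continuation with the explicit one. The other obstacle is uniformity on unbounded paths. On a ray
  with direction \<open>v\<close>, the parameter \<open>l\<close> may move as long as
  \<open>Re (l * v)\<close> keeps half of its negative size, which leaves a common decay rate.
  Differentiating in \<open>l\<close> brings down a factor \<open>t\<close>, which grows linearly
  along the ray; half of that decay rate pays for it.\<close>

lemma linear_times_exp_le:
  fixes x \<eta> :: real
  assumes "0 < \<eta>" "0 \<le> x"
  shows "(1 + x) * exp (- \<eta> * x) \<le> (1 + 2 / \<eta>) * exp (- (\<eta> / 2) * x)"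
proof -
  \<comment> \<open>With \<open>y = \<eta> / 2 * x\<close>, both \<open>y\<close> and 1 are at most
    \<open>exp y\<close>; this is where half of the decay rate is spent.\<close>
  have e: "\<eta> / 2 * x \<le> exp (\<eta> / 2 * x)" "1 \<le> exp (\<eta> / 2 * x)"
    using exp_ge_add_one_self[of "\<eta> / 2 * x"] assms by (smt (verit) divide_nonneg_nonneg mult_nonneg_nonneg)+
  then have "x \<le> 2 / \<eta> * exp (\<eta> / 2 * x)"
    using assms(1) by (simp add: field_simps)
  with e have "1 + x \<le> (1 + 2 / \<eta>) * exp (\<eta> / 2 * x)"
    by (subst distrib_right) linarith
  then have "(1 + x) * exp (- \<eta> * x) \<le> (1 + 2 / \<eta>) * exp (\<eta> / 2 * x) * exp (- \<eta> * x)"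
    by (rule mult_right_mono) simp
  also have "exp (\<eta> / 2 * x) * exp (- \<eta> * x) = exp (- (\<eta> / 2) * x)"
    by (simp flip: exp_add)
  then have "(1 + 2 / \<eta>) * exp (\<eta> / 2 * x) * exp (- \<eta> * x) = (1 + 2 / \<eta>) * exp (- (\<eta> / 2) * x)"
    by (simp add: mult.assoc)
  finally show ?thesis .
qed

lemma integrable_exp_minus_abs:
  fixes \<eta> :: real
  assumes "0 < \<eta>" "S \<in> sets lebesgue"
  shows "(\<lambda>s::real. exp (- \<eta> * \<bar>s\<bar>)) integrable_on S"
proof -
  let ?f = "\<lambda>s::real. exp (- \<eta> * \<bar>s\<bar>)"
  have "(\<lambda>s. exp (- \<eta> * s)) integrable_on {0..}"
    using integrable_on_exp_minus_to_infinity[OF assms(1)] by simp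
  then have pos: "?f integrable_on {0..}"
    by (rule integrable_eq) auto
  then have "?f absolutely_integrable_on {0..}"
    by (rule nonnegative_absolutely_integrable_1) auto
  moreover from this have "(\<lambda>s. ?f (- s)) absolutely_integrable_on {..0}"
    using has_absolute_integral_reflect_real[of "{..0::real}" "{0..}" ?f] by auto
  then have "?f absolutely_integrable_on {..0}"
    by simp
  ultimately have "?f absolutely_integrable_on {0..} \<union> {..0}"
    by (intro set_integrable_Un) auto
  then have "?f absolutely_integrable_on S"
    by (rule set_integrable_subset) (use assms(2) in auto)
  then show ?thesis
    by (rule set_lebesgue_integral_eq_integral(1))
qed

text \<open>Velocities of paths are uncontrolled at break points, hence the finite exceptional set,
  which is negligible. The version on \<open>J - P\<close> serves differentiation under the
  integral, whose hypotheses must hold at every point of the domain.\<close>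

lemma integrable_of_exp_bound:
  fixes f :: "real \<Rightarrow> complex"
  assumes "closed J" "finite P" "0 < \<eta>"
    and cont: "continuous_on (J - P) f"
    and bound: "\<And>s. s \<in> J - P \<Longrightarrow> norm (f s) \<le> C * exp (- \<eta> * \<bar>s\<bar>)"
  shows "f integrable_on J - P" "f integrable_on J"
proof -
  have meas: "J - P \<in> sets lebesgue"
    using assms(1,2) by (intro sets.Diff) (auto intro: borel_closed dest: finite_imp_closed)
  show "f integrable_on J - P"
    by (rule measurable_bounded_by_integrable_imp_integrable[OF
          continuous_imp_measurable_on_sets_lebesgue[OF cont meas] _ bound meas])
      (intro integrable_on_mult_right integrable_exp_minus_abs assms meas)
  then show "f integrable_on J"
    by (rule integrable_spike_set) (auto intro: negligible_subset[OF negligible_finite[OF assms(2)]])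
qed

text \<open>Dominated convergence applied to the difference quotients.\<close>
lemma has_derivative_integral_dominated:
  fixes f :: "'a::real_normed_vector \<Rightarrow> real \<Rightarrow> complex"
  assumes "open U" "convex U" "p \<in> U"
    and f_int: "\<And>q. q \<in> U \<Longrightarrow> f q integrable_on S"
    and der: "\<And>q s. q \<in> U \<Longrightarrow> s \<in> S \<Longrightarrow> ((\<lambda>q. f q s) has_derivative D q s) (at q)"
    and D_int: "\<And>h. (\<lambda>s. D p s h) integrable_on S"
    and bound: "\<And>q s h. q \<in> U \<Longrightarrow> s \<in> S \<Longrightarrow> norm (D q s h) \<le> B s * norm h"
    and B_int: "B integrable_on S"
  shows "((\<lambda>q. integral S (f q)) has_derivative (\<lambda>h. integral S (\<lambda>s. D p s h))) (at p)"
proof -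
  let ?L = "\<lambda>h. integral S (\<lambda>s. D p s h)"
  have lin: "bounded_linear (D p s)" if "s \<in> S" for s
    using der[OF \<open>p \<in> U\<close> that] by (rule has_derivative_bounded_linear)
  have "bounded_linear ?L"
  proof (rule bounded_linear_intro)
    fix x y and r :: real
    show "?L (x + y) = ?L x + ?L y"
      by (subst integral_add[OF D_int D_int, symmetric])
        (intro integral_cong linear_add bounded_linear.linear lin)
    show "?L (r *\<^sub>R x) = r *\<^sub>R ?L x"
      by (subst integral_cmul[symmetric])
        (intro integral_cong linear_cmul bounded_linear.linear lin)
    show "norm (?L x) \<le> norm x * integral S B"
      using integral_norm_bound_integral[OF D_int[of x], of "\<lambda>s. B s * norm x"] bound[OF \<open>p \<in> U\<close>] B_int
      by (simp add: integrable_on_mult_left mult.commute)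
  qed
  moreover
  have "((\<lambda>y. ((integral S (f y) - integral S (f p)) - ?L (y - p)) /\<^sub>R norm (y - p)) \<longlongrightarrow> 0) (at p)"
    unfolding tendsto_at_iff_sequentially o_def
  proof (intro allI impI)
    fix X assume X: "\<forall>i::nat. X i \<in> UNIV - {p}" "X \<longlonglongrightarrow> p"
    define q where "q = (\<lambda>n s. ((f (X n) s - f p s) - D p s (X n - p)) /\<^sub>R norm (X n - p))"
    have "\<forall>\<^sub>F n in sequentially. X n \<in> U"
      using X(2) assms(1,3) by (rule topological_tendstoD)
    then obtain N where N: "\<And>n. n \<ge> N \<Longrightarrow> X n \<in> U"
      by (auto simp: eventually_sequentially)
    \<comment> \<open>Shifting by \<open>N\<close> puts the whole sequence into \<open>U\<close>,
      where integrability and the bounds are available.\<close>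
    have "(\<lambda>n. integral S (q (n + N))) \<longlonglongrightarrow> integral S (\<lambda>s. 0)"
    proof (rule dominated_convergence(2))
      show "q (n + N) integrable_on S" for n
        unfolding q_def by (intro integrable_cmul integrable_diff f_int D_int N assms) simp
      show "(\<lambda>s. 2 * B s) integrable_on S"
        using B_int by simp
      \<comment> \<open>\<open>B s\<close> controls the increment of \<open>f\<close>, by the mean
        value inequality on the convex set \<open>U\<close>, and also its linear part; hence the
        factor 2.\<close>
      show "norm (q (n + N) s) \<le> 2 * B s" if "s \<in> S" for n s
      proof -
        let ?y = "X (n + N)"
        have pos: "0 < norm (?y - p)"
          using X(1) by auto
        have B0: "0 \<le> B s"
          using order_trans[OF norm_ge_zero bound[OF \<open>p \<in> U\<close> that, of "?y - p"]] pos
          by (simp add: zero_le_mult_iff)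
        have "norm (f ?y s - f p s) \<le> B s * norm (?y - p)"
          using assms(2) _ _ N[of "n + N"] assms(3)
        proof (rule differentiable_bound)
          show "((\<lambda>q. f q s) has_derivative D q s) (at q within U)" if "q \<in> U" for q
            using der[OF that \<open>s \<in> S\<close>] by (rule has_derivative_at_withinI)
          show "onorm (D q s) \<le> B s" if "q \<in> U" for q
            using B0 bound[OF that \<open>s \<in> S\<close>] by (rule onorm_bound)
        qed simp
        moreover have "norm (D p s (?y - p)) \<le> B s * norm (?y - p)"
          by (rule bound[OF \<open>p \<in> U\<close> that])
        ultimately have "norm ((f ?y s - f p s) - D p s (?y - p)) \<le> 2 * B s * norm (?y - p)"
          using norm_triangle_ineq4[of "f ?y s - f p s" "D p s (?y - p)"] by linarith
        then show ?thesis
          using pos by (simp add: q_def pos_divide_le_eq[symmetric] divide_inverse_commute)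
      qed
      show "(\<lambda>n. q (n + N) s) \<longlonglongrightarrow> 0" if "s \<in> S" for s
      proof (rule LIMSEQ_ignore_initial_segment)
        have "((\<lambda>y. ((f y s - f p s) - D p s (y - p)) /\<^sub>R norm (y - p)) \<longlongrightarrow> 0) (at p)"
          using der[OF \<open>p \<in> U\<close> that] by (simp add: has_derivative_at_within)
        then show "(\<lambda>n. q n s) \<longlonglongrightarrow> 0"
          using X unfolding q_def tendsto_at_iff_sequentially o_def by blast
      qed
    qed
    moreover have "integral S (q (n + N)) =
        ((integral S (f (X (n + N))) - integral S (f p)) - ?L (X (n + N) - p)) /\<^sub>R norm (X (n + N) - p)" for n
      unfolding q_def using N[of "n + N"] assms(3)
      by (simp add: integral_diff integrable_diff f_int D_int)
    ultimately have "(\<lambda>n. ((integral S (f (X (n + N))) - integral S (f p)) - ?L (X (n + N) - p)) /\<^sub>R norm (X (n + N) - p))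
        \<longlonglongrightarrow> 0"
      by simp
    then show "(\<lambda>n. ((integral S (f (X n)) - integral S (f p)) - ?L (X n - p)) /\<^sub>R norm (X n - p))
        \<longlonglongrightarrow> 0"
      by (rule LIMSEQ_offset)
  qed
  ultimately show ?thesis
    by (rule has_derivativeI)
qed

lemma exp_minus_abs_tendsto_0:
  fixes \<eta> :: real
  assumes "0 < \<eta>" "filterlim X at_infinity F"
  shows "((\<lambda>n. C * exp (- \<eta> * \<bar>X n\<bar>)) \<longlongrightarrow> 0) F"
proof -
  have "filterlim (\<lambda>n. \<bar>X n\<bar>) at_top F"
    using filterlim_at_infinity_imp_norm_at_top[OF assms(2)] by simp
  then have "((\<lambda>n. exp (- (\<eta> * \<bar>X n\<bar>))) \<longlongrightarrow> 0) F"
    using filterlim_tendsto_pos_mult_at_top[OF tendsto_const assms(1)]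
    by (intro filterlim_compose[OF exp_at_bot]) (auto simp: filterlim_uminus_at_bot)
  then show ?thesis
    by (auto intro: tendsto_mult_right_zero)
qed

text \<open>\<open>J\<close> is exhausted by compact intervals that stand still at a finite end and
  move outwards at an infinite one. The usual theorem holds on each of them. Decay of
  \<open>G\<close> lets the integrals converge by domination, and decay of \<open>F\<close> makes an
  infinite end contribute 0.\<close>

lemma fundamental_theorem_of_calculus_decaying:
  fixes F :: "real \<Rightarrow> complex"
  assumes J: "is_interval J" "closed J" "J \<noteq> {}" and "finite P"
    and cont: "continuous_on J F"
    and der: "\<And>s. s \<in> interior J - P \<Longrightarrow> (F has_vector_derivative G s) (at s)"
    and "0 < \<eta>"
    and G_bound: "\<And>s. s \<in> J - P \<Longrightarrow> norm (G s) \<le> C * exp (- \<eta> * \<bar>s\<bar>)"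
    and F_bound: "\<And>s. s \<in> J \<Longrightarrow> norm (F s) \<le> C * exp (- \<eta> * \<bar>s\<bar>)"
  shows "(G has_integral
      (if bdd_above J then F (Sup J) else 0) - (if bdd_below J then F (Inf J) else 0)) J"
proof -
  obtain a where a: "a \<in> J"
    using J(3) by blast
  define lo where "lo = (\<lambda>n::nat. if bdd_below J then Inf J else a - real n)"
  define hi where "hi = (\<lambda>n::nat. if bdd_above J then Sup J else a + real n)"
  have unb_above: "x \<in> J" if "\<not> bdd_above J" "a \<le> x" for x
    using that J(1) a by (meson bdd_aboveI is_interval_1 linear)
  have unb_below: "x \<in> J" if "\<not> bdd_below J" "x \<le> a" for x
    using that J(1) a by (meson bdd_belowI is_interval_1 linear)
  have lohi: "lo n \<in> J" "hi n \<in> J" "lo n \<le> a" "a \<le> hi n" for n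
    using a J unb_above unb_below
    by (auto simp: lo_def hi_def closed_contains_Inf closed_contains_Sup cInf_lower cSup_upper)
  then have sub: "{lo n..hi n} \<subseteq> J" for n
    using J(1) by (meson atLeastAtMost_iff is_interval_1 subsetI)
  have ev: "\<forall>\<^sub>F n in sequentially. s \<in> {lo n..hi n}" if "s \<in> J" for s
  proof -
    obtain N where N: "\<bar>s - a\<bar> \<le> real N"
      using real_arch_simple by blast
    have "s \<in> {lo n..hi n}" if "n \<ge> N" for n
      using N that \<open>s \<in> J\<close> by (auto simp: lo_def hi_def cInf_lower cSup_upper)
    then show ?thesis
      by (auto simp: eventually_sequentially)
  qed
  have lim_hi: "(\<lambda>n. F (hi n)) \<longlonglongrightarrow> (if bdd_above J then F (Sup J) else 0)"
  proof (cases "bdd_above J")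
    case False
    have "filterlim (\<lambda>n. a + real n) at_infinity sequentially"
      by (intro filterlim_at_top_imp_at_infinity filterlim_tendsto_add_at_top[OF tendsto_const]
          filterlim_real_sequentially)
    then have "(\<lambda>n. C * exp (- \<eta> * \<bar>hi n\<bar>)) \<longlonglongrightarrow> 0"
      using False exp_minus_abs_tendsto_0[OF \<open>0 < \<eta>\<close>] by (simp add: hi_def)
    then have "(\<lambda>n. F (hi n)) \<longlonglongrightarrow> 0"
      by (rule Lim_null_comparison[OF always_eventually[OF allI[OF F_bound[OF lohi(2)]]]])
    then show ?thesis
      using False by simp
  qed (simp add: hi_def)
  have lim_lo: "(\<lambda>n. F (lo n)) \<longlonglongrightarrow> (if bdd_below J then F (Inf J) else 0)"
  proof (cases "bdd_below J")
    case False
    have "filterlim (\<lambda>n. - (- a + real n)) at_infinity sequentially"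
      by (intro filterlim_at_bot_imp_at_infinity filterlim_uminus_at_top[THEN iffD1]
          filterlim_tendsto_add_at_top[OF tendsto_const] filterlim_real_sequentially)
    then have "(\<lambda>n. C * exp (- \<eta> * \<bar>lo n\<bar>)) \<longlonglongrightarrow> 0"
      using False exp_minus_abs_tendsto_0[OF \<open>0 < \<eta>\<close>] by (simp add: lo_def)
    then have "(\<lambda>n. F (lo n)) \<longlonglongrightarrow> 0"
      by (rule Lim_null_comparison[OF always_eventually[OF allI[OF F_bound[OF lohi(1)]]]])
    then show ?thesis
      using False by simp
  qed (simp add: lo_def)
  \<comment> \<open>The hypotheses say nothing about \<open>G\<close> on \<open>P\<close>, so its
    values there are reset to 0; then one dominating function works on all of
    \<open>J\<close>.\<close>
  have "((\<lambda>s. if s \<in> P then 0 else G s) has_integral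
      (if bdd_above J then F (Sup J) else 0) - (if bdd_below J then F (Inf J) else 0)) J"
  proof (rule has_integral_dominated_convergence)
    fix n
    have "(G has_integral F (hi n) - F (lo n)) {lo n..hi n}"
    proof (rule fundamental_theorem_of_calculus_interior_strong[OF \<open>finite P\<close>])
      show "lo n \<le> hi n"
        using lohi(3,4)[of n] by linarith
      show "continuous_on {lo n..hi n} F"
        using cont sub by (rule continuous_on_subset)
      show "(F has_vector_derivative G s) (at s)" if "s \<in> {lo n<..<hi n} - P" for s
        using that sub[of n] interior_mono[OF sub[of n]] by (intro der) (auto simp: interior_atLeastAtMost_real)
    qed
    then have "((\<lambda>s. if s \<in> P then 0 else G s) has_integral F (hi n) - F (lo n)) {lo n..hi n}"
      by (rule has_integral_spike_finite[OF \<open>finite P\<close>, rotated]) auto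
    then show "((\<lambda>s. if s \<in> {lo n..hi n} then if s \<in> P then 0 else G s else 0) has_integral
        F (hi n) - F (lo n)) J"
      by (subst has_integral_restrict[OF sub])
  next
    show "(\<lambda>s. \<bar>C\<bar> * exp (- \<eta> * \<bar>s\<bar>)) integrable_on J"
      using integrable_exp_minus_abs[OF \<open>0 < \<eta>\<close>, of J] J(2)
      by (auto intro!: integrable_on_mult_right borel_closed)
    show "\<forall>s\<in>J. norm (if s \<in> {lo n..hi n} then if s \<in> P then 0 else G s else 0)
        \<le> \<bar>C\<bar> * exp (- \<eta> * \<bar>s\<bar>)" for n
    proof
      fix s assume "s \<in> J"
      have "C * exp (- \<eta> * \<bar>s\<bar>) \<le> \<bar>C\<bar> * exp (- \<eta> * \<bar>s\<bar>)"
        by (intro mult_right_mono) auto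
      then have "s \<notin> P \<Longrightarrow> norm (G s) \<le> \<bar>C\<bar> * exp (- \<eta> * \<bar>s\<bar>)"
        using G_bound[of s] \<open>s \<in> J\<close> by (intro order_trans[OF G_bound]) auto
      then show "norm (if s \<in> {lo n..hi n} then if s \<in> P then 0 else G s else 0) \<le> \<bar>C\<bar> * exp (- \<eta> * \<bar>s\<bar>)"
        by simp
    qed
    show "\<forall>s\<in>J. (\<lambda>n. if s \<in> {lo n..hi n} then if s \<in> P then 0 else G s else 0)
        \<longlonglongrightarrow> (if s \<in> P then 0 else G s)"
    proof (intro ballI tendsto_eventually)
      fix s assume "s \<in> J"
      from ev[OF this] show "\<forall>\<^sub>F n in sequentially.
          (if s \<in> {lo n..hi n} then if s \<in> P then 0 else G s else 0) = (if s \<in> P then 0 else G s)"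
        by (rule eventually_mono) simp
    qed
    show "(\<lambda>n. F (hi n) - F (lo n)) \<longlonglongrightarrow>
        (if bdd_above J then F (Sup J) else 0) - (if bdd_below J then F (Inf J) else 0)"
      by (intro tendsto_diff lim_hi lim_lo)
  qed
  then show ?thesis
    by (rule has_integral_spike_finite[OF \<open>finite P\<close>, rotated]) auto
qed

section \<open>Branches\<close>

text \<open>Continuity selects the root: near \<open>x\<close> the quotient \<open>f y / f x\<close>
  has positive real part and is therefore the principal root of its square. Dividing by
  \<open>f x\<close> moves the argument of \<open>csqrt\<close> to 1, away from the cut.\<close>

lemma has_derivative_of_square:
  fixes f :: "'a::real_normed_vector \<Rightarrow> complex"
  assumes cont: "isCont f x" and nz: "f x \<noteq> 0"
    and sq: "((\<lambda>y. (f y)\<^sup>2) has_derivative Q') (at x)"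
  shows "(f has_derivative (\<lambda>h. Q' h / (2 * f x))) (at x)"
proof -
  have "((\<lambda>y. (f y)\<^sup>2 / (f x)\<^sup>2) has_derivative (\<lambda>h. Q' h / (f x)\<^sup>2)) (at x)"
    using has_derivative_mult_left[OF sq, of "inverse ((f x)\<^sup>2)"] by (simp add: field_simps)
  moreover have "(csqrt has_derivative (*) (inverse 2)) (at ((f x)\<^sup>2 / (f x)\<^sup>2))"
    using has_field_derivative_csqrt[of 1] nz
    by (simp add: has_field_derivative_def inverse_eq_divide)
  ultimately have "((\<lambda>y. csqrt ((f y)\<^sup>2 / (f x)\<^sup>2)) has_derivative
      (\<lambda>h. inverse 2 * (Q' h / (f x)\<^sup>2))) (at x)"
    by (rule has_derivative_compose)
  then have 1: "((\<lambda>y. f x * csqrt ((f y)\<^sup>2 / (f x)\<^sup>2)) has_derivative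
      (\<lambda>h. f x * (inverse 2 * (Q' h / (f x)\<^sup>2)))) (at x)"
    by (rule has_derivative_mult_right)
  have "isCont (\<lambda>y. f y / f x) x"
    using cont nz by (intro continuous_intros) auto
  then have "((\<lambda>y. Re (f y / f x)) \<longlongrightarrow> Re (f x / f x)) (at x)"
    unfolding isCont_def by (rule tendsto_Re)
  then have ev: "\<forall>\<^sub>F y in at x. 0 < Re (f y / f x)"
    using nz by (intro order_tendstoD) auto
  have "\<forall>\<^sub>F y in at x. f x * csqrt ((f y)\<^sup>2 / (f x)\<^sup>2) = f y"
    using ev
  proof eventually_elim
    case (elim y)
    then have "csqrt ((f y / f x)\<^sup>2) = f y / f x"
      by (intro csqrt_square) auto
    then show ?case
      using nz by (simp add: power_divide)
  qed
  then have "(f has_derivative (\<lambda>h. f x * (inverse 2 * (Q' h / (f x)\<^sup>2)))) (at x)"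
    using nz by (intro has_derivative_transform_eventually[OF 1]) auto
  then show ?thesis
    using nz by (simp add: field_simps power2_eq_square)
qed

lemma has_derivative_prod_log:
  fixes f :: "'i \<Rightarrow> 'a::real_normed_vector \<Rightarrow> 'b::real_normed_field"
  assumes "\<And>i. i \<in> I \<Longrightarrow> (f i has_derivative f' i) (at x)" "\<And>i. i \<in> I \<Longrightarrow> f i x \<noteq> 0" "finite I"
  shows "((\<lambda>y. \<Prod>i\<in>I. f i y) has_derivative (\<lambda>h. (\<Prod>i\<in>I. f i x) * (\<Sum>i\<in>I. f' i h / f i x))) (at x)"
proof -
  have "(\<Sum>i\<in>I. f' i h * (\<Prod>j\<in>I - {i}. f j x)) = (\<Prod>i\<in>I. f i x) * (\<Sum>i\<in>I. f' i h / f i x)" for h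
    unfolding sum_distrib_left
    by (intro sum.cong) (auto simp: prod.remove[OF assms(3)] assms(2))
  then show ?thesis
    using has_derivative_prod[of I f f' x UNIV] assms(1) by simp
qed

lemma Phi_values_square:
  assumes "v \<in> Phi_values p t"
  shows "v\<^sup>2 = exp (2 * snd p * t) * (\<Prod>i\<in>UNIV. inverse (t - fst p $ i))"
proof -
  obtain r where v: "v = exp (snd p * t) * (\<Prod>i\<in>UNIV. r i)"
    and r: "\<And>i. (r i)\<^sup>2 * (t - fst p $ i) = 1"
    using assms by (auto simp: Phi_values_def)
  have "(r i)\<^sup>2 = inverse (t - fst p $ i)" for i
    using r[of i] by (metis inverse_unique mult.commute)
  then show ?thesis
    by (simp add: v power_mult_distrib prod_power_distrib mult.assoc flip: exp_double)
qed

lemma Phi_values_nonzero: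
  assumes "v \<in> Phi_values p t"
  shows "v \<noteq> 0" "t \<noteq> fst p $ i"
  using assms by (auto simp: Phi_values_def) (metis mult_zero_left mult_zero_right diff_self zero_neq_one zero_power2)+

lemma norm_Phi_values_le:
  fixes p :: "'n::finite params"
  assumes "v \<in> Phi_values p t" "0 < d" "\<And>i. d \<le> norm (t - fst p $ i)"
  shows "norm v \<le> exp (Re (snd p * t)) * sqrt (inverse d) ^ CARD('n)"
proof (rule power2_le_imp_le)
  have "(norm v)\<^sup>2 = (exp (Re (snd p * t)))\<^sup>2 * (\<Prod>i\<in>UNIV. inverse (norm (t - fst p $ i)))"
    unfolding norm_power[symmetric] Phi_values_square[OF assms(1)]
    by (simp add: norm_mult prod_norm[symmetric] norm_inverse exp_double[symmetric] algebra_simps)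
  also have "\<dots> \<le> (exp (Re (snd p * t)))\<^sup>2 * (\<Prod>i\<in>(UNIV::'n set). inverse d)"
    using assms(2,3) by (intro mult_left_mono prod_mono) (auto intro: le_imp_inverse_le)
  also have "\<dots> = (exp (Re (snd p * t)) * sqrt (inverse d) ^ CARD('n))\<^sup>2"
    using assms(2) by (simp add: power_mult_distrib power2_eq_square flip: power_mult_distrib)
  finally show "(norm v)\<^sup>2 \<le> (exp (Re (snd p * t)) * sqrt (inverse d) ^ CARD('n))\<^sup>2" .
qed (use assms(2) in simp)

text \<open>Both the parameters and the point may move with \<open>y\<close>, so that one chain rule
  serves two purposes: constant \<open>q\<close> gives the derivative along a path, constant
  \<open>t\<close> the derivative in the parameters.\<close>

lemma Phi_branch_has_derivative:
  fixes \<psi> :: "'a::real_normed_vector \<Rightarrow> complex" and q :: "'a \<Rightarrow> 'n::finite params"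
  assumes val: "\<forall>\<^sub>F y in nhds x. \<psi> y \<in> Phi_values (q y) (t y)"
    and cont: "isCont \<psi> x"
    and q: "(q has_derivative q') (at x)"
    and t: "(t has_derivative t') (at x)"
  shows "(\<psi> has_derivative (\<lambda>h. \<psi> x * (snd (q' h) * t x + snd (q x) * t' h
           - 1 / 2 * (\<Sum>i\<in>UNIV. (t' h - fst (q' h) $ i) / (t x - fst (q x) $ i))))) (at x)"
proof -
  have v: "\<psi> x \<in> Phi_values (q x) (t x)"
    using val by (rule eventually_nhds_x_imp_x)
  note nz = Phi_values_nonzero[OF v]
  have "((\<lambda>y. t y - fst (q y) $ i) has_derivative (\<lambda>h. t' h - fst (q' h) $ i)) (at x)" for i
    using q t by (intro has_derivative_diff bounded_linear.has_derivative[OF bounded_linear_vec_nth]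
        has_derivative_fst)
  then have "((\<lambda>y. inverse (t y - fst (q y) $ i)) has_derivative
      (\<lambda>h. - (inverse (t x - fst (q x) $ i) * (t' h - fst (q' h) $ i) * inverse (t x - fst (q x) $ i)))) (at x)" for i
    using nz by (intro Deriv.has_derivative_inverse) auto
  then have "((\<lambda>y. \<Prod>i\<in>UNIV. inverse (t y - fst (q y) $ i)) has_derivative
      (\<lambda>h. (\<Prod>i\<in>UNIV. inverse (t x - fst (q x) $ i)) *
        (\<Sum>i\<in>UNIV. - (inverse (t x - fst (q x) $ i) * (t' h - fst (q' h) $ i) * inverse (t x - fst (q x) $ i))
           / inverse (t x - fst (q x) $ i)))) (at x)"
    using nz by (intro has_derivative_prod_log) auto
  also have "(\<lambda>h. \<Sum>i\<in>UNIV. - (inverse (t x - fst (q x) $ i) * (t' h - fst (q' h) $ i) * inverse (t x - fst (q x) $ i))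
           / inverse (t x - fst (q x) $ i)) = (\<lambda>h. - (\<Sum>i\<in>UNIV. (t' h - fst (q' h) $ i) / (t x - fst (q x) $ i)))"
    using nz by (auto simp: sum_negf[symmetric] divide_simps intro!: sum.cong)
  finally have prod: "((\<lambda>y. \<Prod>i\<in>UNIV. inverse (t y - fst (q y) $ i)) has_derivative
      (\<lambda>h. (\<Prod>i\<in>UNIV. inverse (t x - fst (q x) $ i)) *
        - (\<Sum>i\<in>UNIV. (t' h - fst (q' h) $ i) / (t x - fst (q x) $ i)))) (at x)"
    by simp
  have ex: "((\<lambda>y. exp (2 * snd (q y) * t y)) has_derivative
      (\<lambda>h. exp (2 * snd (q x) * t x) * (2 * (snd (q' h) * t x + snd (q x) * t' h)))) (at x)"
    using has_derivative_compose[OF has_derivative_mult[OF has_derivative_mult_right[OF has_derivative_snd[OF q], of 2] t]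
        DERIV_exp[unfolded has_field_derivative_def]]
    by (rule has_derivative_eq_rhs) (simp add: algebra_simps)
  let ?E = "exp (2 * snd (q x) * t x)" and ?R = "\<Prod>i\<in>UNIV. inverse (t x - fst (q x) $ i)"
  have "((\<lambda>y. exp (2 * snd (q y) * t y) * (\<Prod>i\<in>UNIV. inverse (t y - fst (q y) $ i))) has_derivative
      (\<lambda>h. ?E * (?R * - (\<Sum>i\<in>UNIV. (t' h - fst (q' h) $ i) / (t x - fst (q x) $ i)))
        + ?E * (2 * (snd (q' h) * t x + snd (q x) * t' h)) * ?R)) (at x)"
    by (rule has_derivative_mult[OF ex prod])
  then have "((\<lambda>y. (\<psi> y)\<^sup>2) has_derivative
      (\<lambda>h. ?E * (?R * - (\<Sum>i\<in>UNIV. (t' h - fst (q' h) $ i) / (t x - fst (q x) $ i)))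
        + ?E * (2 * (snd (q' h) * t x + snd (q x) * t' h)) * ?R)) (at x)"
    by (rule has_derivative_transform_eventually)
      (use val v in \<open>auto simp: Phi_values_square eventually_nhds_conv_at elim!: eventually_mono\<close>)
  from has_derivative_of_square[OF cont nz(1) this]
  show ?thesis
  proof (rule has_derivative_eq_rhs, intro ext)
    fix h
    let ?S = "\<Sum>i\<in>UNIV. (t' h - fst (q' h) $ i) / (t x - fst (q x) $ i)"
    have "?E * (?R * - ?S) + ?E * (2 * (snd (q' h) * t x + snd (q x) * t' h)) * ?R
        = (\<psi> x)\<^sup>2 * (2 * (snd (q' h) * t x + snd (q x) * t' h) - ?S)"
      by (simp add: Phi_values_square[OF v] algebra_simps)
    then show "(?E * (?R * - ?S) + ?E * (2 * (snd (q' h) * t x + snd (q x) * t' h)) * ?R) / (2 * \<psi> x)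
        = \<psi> x * (snd (q' h) * t x + snd (q x) * t' h - 1 / 2 * ?S)"
      using nz(1) by (simp only:) (simp add: field_simps power2_eq_square)
  qed
qed

section \<open>Integrals along a single path\<close>

text \<open>
  All bounds are uniform for parameters in \<open>U\<close>. Besides the break points, \<open>P\<close> has to contain the
  finite end points of \<open>J\<close>, where the two-sided derivative may fail to exist.
\<close>
locale tame_path =
  fixes U :: "'n::finite params set" and J :: "real set" and \<gamma> :: "real \<Rightarrow> complex"
    and P :: "real set" and B \<eta> d :: real
  assumes J: "is_interval J" "closed J" "J \<noteq> {}"
    and cont: "continuous_on J \<gamma>"
    and finite_P: "finite P"
    and pos: "0 < B" "0 < \<eta>" "0 < d"
    and deriv: "\<And>s. s \<in> J - P \<Longrightarrow> (\<gamma> has_vector_derivative vector_derivative \<gamma> (at s)) (at s)"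
    and deriv_cont: "continuous_on (J - P) (\<lambda>s. vector_derivative \<gamma> (at s))"
    and deriv_bound: "\<And>s. s \<in> J - P \<Longrightarrow> norm (vector_derivative \<gamma> (at s)) \<le> B"
    and growth: "\<And>s. s \<in> J \<Longrightarrow> norm (\<gamma> s) \<le> B * (1 + \<bar>s\<bar>)"
    and decay: "\<And>p s. p \<in> U \<Longrightarrow> s \<in> J \<Longrightarrow> Re (snd p * \<gamma> s) \<le> B - \<eta> * \<bar>s\<bar>"
    and sep: "\<And>p s i. p \<in> U \<Longrightarrow> s \<in> J \<Longrightarrow> d \<le> norm (\<gamma> s - fst p $ i)"
begin

text \<open>\<open>exp B\<close> comes from \<open>decay\<close>, and each singular point
  contributes \<open>sqrt (1 / d)\<close> by \<open>sep\<close>.\<close>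

definition branch_const :: real where
  "branch_const = exp B * sqrt (inverse d) ^ CARD('n)"

lemma branch_const_pos: "0 < branch_const"
  using pos by (simp add: branch_const_def)

lemma branch_bound:
  assumes "p \<in> U" "Phi_branch_along p J \<gamma> \<psi>" "s \<in> J"
  shows "norm (\<psi> s) \<le> branch_const * exp (- \<eta> * \<bar>s\<bar>)"
proof -
  have "norm (\<psi> s) \<le> exp (Re (snd p * \<gamma> s)) * sqrt (inverse d) ^ CARD('n)"
    using assms pos sep by (intro norm_Phi_values_le) (auto simp: Phi_branch_along_def)
  also have "\<dots> \<le> exp (B - \<eta> * \<bar>s\<bar>) * sqrt (inverse d) ^ CARD('n)"
    using decay[OF assms(1,3)] pos by (intro mult_right_mono) auto
  also have "\<dots> = branch_const * exp (- \<eta> * \<bar>s\<bar>)"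
    by (simp add: branch_const_def exp_diff exp_minus field_simps)
  finally show ?thesis .
qed

lemma singular_point_avoided: "p \<in> U \<Longrightarrow> s \<in> J \<Longrightarrow> \<gamma> s \<noteq> fst p $ i"
  using sep[of p s i] pos by auto

lemma norm_inverse_le: "p \<in> U \<Longrightarrow> s \<in> J \<Longrightarrow> norm (1 / (\<gamma> s - fst p $ i)) \<le> 1 / d"
  using sep[of p s i] pos by (auto simp: norm_divide intro!: divide_left_mono mult_pos_pos)

text \<open>The bound for a branch times the bound for the velocity, times the constant of
  \<open>linear_times_exp_le\<close>, which absorbs a weight of linear growth.\<close>

definition moment_const :: real where
  "moment_const = branch_const * B * (1 + 2 / \<eta>)"

lemma moment_bound:
  assumes "p \<in> U" "Phi_branch_along p J \<gamma> \<psi>" "s \<in> J - P" "0 \<le> K" "norm u \<le> K * (1 + \<bar>s\<bar>)"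
  shows "norm (u * \<psi> s * vector_derivative \<gamma> (at s)) \<le> K * moment_const * exp (- (\<eta> / 2) * \<bar>s\<bar>)"
proof -
  have "norm (u * \<psi> s * vector_derivative \<gamma> (at s))
      \<le> (K * (1 + \<bar>s\<bar>)) * (branch_const * exp (- \<eta> * \<bar>s\<bar>)) * B"
    unfolding norm_mult using assms branch_const_pos
    by (intro mult_mono branch_bound deriv_bound) auto
  also have "\<dots> = K * branch_const * B * ((1 + \<bar>s\<bar>) * exp (- \<eta> * \<bar>s\<bar>))"
    by simp
  also have "\<dots> \<le> K * branch_const * B * ((1 + 2 / \<eta>) * exp (- (\<eta> / 2) * \<bar>s\<bar>))"
    using assms pos branch_const_pos by (intro mult_left_mono linear_times_exp_le) auto
  finally show ?thesis
    by (simp add: moment_const_def mult_ac)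
qed

lemma moment_integrable:
  assumes "p \<in> U" "Phi_branch_along p J \<gamma> \<psi>" "0 \<le> K"
    and "continuous_on J u" "\<And>s. s \<in> J \<Longrightarrow> norm (u s) \<le> K * (1 + \<bar>s\<bar>)"
  shows "(\<lambda>s. u s * \<psi> s * vector_derivative \<gamma> (at s)) integrable_on J - P"
    "(\<lambda>s. u s * \<psi> s * vector_derivative \<gamma> (at s)) integrable_on J"
proof -
  have c: "continuous_on (J - P) (\<lambda>s. u s * \<psi> s * vector_derivative \<gamma> (at s))"
    using assms(2,4) deriv_cont
    by (intro continuous_intros) (auto simp: Phi_branch_along_def intro: continuous_on_subset)
  have b: "norm (u s * \<psi> s * vector_derivative \<gamma> (at s)) \<le> K * moment_const * exp (- (\<eta> / 2) * \<bar>s\<bar>)"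
    if "s \<in> J - P" for s
    using assms that by (intro moment_bound) auto
  show "(\<lambda>s. u s * \<psi> s * vector_derivative \<gamma> (at s)) integrable_on J - P"
    "(\<lambda>s. u s * \<psi> s * vector_derivative \<gamma> (at s)) integrable_on J"
    using integrable_of_exp_bound[OF J(2) finite_P _ c b] pos by auto
qed

lemma bounded_moment_integrable:
  assumes "p \<in> U" "Phi_branch_along p J \<gamma> \<psi>"
    and "continuous_on J u" "\<And>s. s \<in> J \<Longrightarrow> norm (u s) \<le> K"
  shows "(\<lambda>s. u s * \<psi> s * vector_derivative \<gamma> (at s)) integrable_on J"
proof (rule moment_integrable(2)[OF assms(1,2) _ assms(3)])
  show "0 \<le> \<bar>K\<bar>" by simp
  show "norm (u s) \<le> \<bar>K\<bar> * (1 + \<bar>s\<bar>)" if "s \<in> J" for s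
    using assms(4)[OF that] mult_left_mono[of 1 "1 + \<bar>s\<bar>" "\<bar>K\<bar>"] by auto
qed

lemma continuous_on_inverse_diff:
  "p \<in> U \<Longrightarrow> continuous_on J (\<lambda>s. 1 / (\<gamma> s - fst p $ i))"
  using singular_point_avoided by (intro continuous_intros cont) auto

text \<open>The integrand is the pull-back of the exact form d(\<Phi> h), because the logarithmic
  derivative of \<Phi> in t is
  \<open>snd p - 1 / 2 * (\<Sum>j\<in>UNIV. 1 / (t - fst p $ j))\<close>. Boundedness of
  \<open>h\<close> and \<open>h'\<close> on the path preserves the exponential decay, so only finite
  ends are seen.\<close>

lemma Stokes:
  assumes p: "p \<in> U" and br: "Phi_branch_along p J \<gamma> \<psi>"
    and h: "\<And>s. s \<in> J \<Longrightarrow> (h has_field_derivative h' (\<gamma> s)) (at (\<gamma> s))"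
    and bound: "\<And>s. s \<in> J \<Longrightarrow> norm (h (\<gamma> s)) \<le> K" "\<And>s. s \<in> J \<Longrightarrow> norm (h' (\<gamma> s)) \<le> K"
  shows "((\<lambda>s. ((snd p - 1 / 2 * (\<Sum>j\<in>UNIV. 1 / (\<gamma> s - fst p $ j))) * h (\<gamma> s) + h' (\<gamma> s))
              * \<psi> s * vector_derivative \<gamma> (at s)) has_integral
     (if bdd_above J then \<psi> (Sup J) * h (\<gamma> (Sup J)) else 0) -
     (if bdd_below J then \<psi> (Inf J) * h (\<gamma> (Inf J)) else 0)) J"
proof -
  obtain s0 where "s0 \<in> J" using J by blast
  then have "0 \<le> K"
    using bound(1)[of s0] norm_ge_zero order_trans by blast
  define K' where "K' = (norm (snd p) + 1 / 2 * (real CARD('n) * (1 / d))) * K + K"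
  have K': "0 \<le> K'"
    using \<open>0 \<le> K\<close> pos by (auto simp: K'_def)
  have wt: "norm ((snd p - 1 / 2 * (\<Sum>j\<in>UNIV. 1 / (\<gamma> s - fst p $ j))) * h (\<gamma> s) + h' (\<gamma> s)) \<le> K' * (1 + \<bar>s\<bar>)"
    if "s \<in> J" for s
  proof -
    have "norm (\<Sum>j\<in>UNIV. 1 / (\<gamma> s - fst p $ j)) \<le> (\<Sum>j\<in>(UNIV::'n set). 1 / d)"
      by (intro sum_norm_le norm_inverse_le that p)
    then have "norm (1 / 2 * (\<Sum>j\<in>UNIV. 1 / (\<gamma> s - fst p $ j))) \<le> 1 / 2 * (real CARD('n) * (1 / d))"
      by (simp only: norm_mult) simp
    then have "norm (snd p - 1 / 2 * (\<Sum>j\<in>UNIV. 1 / (\<gamma> s - fst p $ j))) \<le>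
        norm (snd p) + 1 / 2 * (real CARD('n) * (1 / d))"
      using norm_triangle_ineq4[of "snd p" "1 / 2 * (\<Sum>j\<in>UNIV. 1 / (\<gamma> s - fst p $ j))"] by linarith
    then have "norm ((snd p - 1 / 2 * (\<Sum>j\<in>UNIV. 1 / (\<gamma> s - fst p $ j))) * h (\<gamma> s)) \<le>
        (norm (snd p) + 1 / 2 * (real CARD('n) * (1 / d))) * K"
      unfolding norm_mult using bound(1)[OF that] pos by (intro mult_mono) auto
    then have "norm ((snd p - 1 / 2 * (\<Sum>j\<in>UNIV. 1 / (\<gamma> s - fst p $ j))) * h (\<gamma> s) + h' (\<gamma> s)) \<le> K'"
      unfolding K'_def using bound(2)[OF that] norm_triangle_le by (meson add_mono order_trans norm_triangle_ineq)
    also have "K' \<le> K' * (1 + \<bar>s\<bar>)"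
      using mult_left_mono[of 1 "1 + \<bar>s\<bar>" K'] K' by simp
    finally show ?thesis .
  qed
  \<comment> \<open>One constant and one rate have to serve the primitive and its derivative. The
    primitive decays at rate \<open>\<eta>\<close>, but \<open>moment_bound\<close> gives only
    \<open>\<eta> / 2\<close> for the derivative, so the slower rate is used for both.\<close>
  define C where "C = max (K * branch_const) (K' * moment_const)"
  show ?thesis
  proof (rule fundamental_theorem_of_calculus_decaying[OF J finite_P, where \<eta> = "\<eta> / 2" and C = C])
    have "continuous_on (\<gamma> ` J) h"
      using h by (auto intro!: continuous_at_imp_continuous_on DERIV_isCont)
    then have "continuous_on J (\<lambda>s. h (\<gamma> s))"
      using cont by (rule continuous_on_compose2) auto
    then show "continuous_on J (\<lambda>s. \<psi> s * h (\<gamma> s))"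
      using br by (intro continuous_intros) (auto simp: Phi_branch_along_def)
    show "0 < \<eta> / 2"
      using pos by simp
    show "norm (\<psi> s * h (\<gamma> s)) \<le> C * exp (- (\<eta> / 2) * \<bar>s\<bar>)" if "s \<in> J" for s
    proof -
      have "norm (\<psi> s * h (\<gamma> s)) \<le> (branch_const * exp (- \<eta> * \<bar>s\<bar>)) * K"
        unfolding norm_mult using branch_bound[OF p br that] bound(1)[OF that] branch_const_pos
        by (intro mult_mono) auto
      also have "\<dots> = K * branch_const * exp (- \<eta> * \<bar>s\<bar>)"
        by simp
      also have "\<dots> \<le> C * exp (- (\<eta> / 2) * \<bar>s\<bar>)"
        using pos \<open>0 \<le> K\<close> branch_const_pos
        by (intro mult_mono) (auto simp: C_def le_max_iff_disj intro!: mult_right_mono)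
      finally show ?thesis .
    qed
    show "norm (((snd p - 1 / 2 * (\<Sum>j\<in>UNIV. 1 / (\<gamma> s - fst p $ j))) * h (\<gamma> s) + h' (\<gamma> s))
              * \<psi> s * vector_derivative \<gamma> (at s)) \<le> C * exp (- (\<eta> / 2) * \<bar>s\<bar>)" if "s \<in> J - P" for s
      using that by (intro order_trans[OF moment_bound[OF p br that K' wt]] mult_right_mono)
        (auto simp: C_def)
    show "((\<lambda>s. \<psi> s * h (\<gamma> s)) has_vector_derivative
        ((snd p - 1 / 2 * (\<Sum>j\<in>UNIV. 1 / (\<gamma> s - fst p $ j))) * h (\<gamma> s) + h' (\<gamma> s))
          * \<psi> s * vector_derivative \<gamma> (at s)) (at s)" if s: "s \<in> interior J - P" for s
    proof -
      let ?g = "vector_derivative \<gamma> (at s)"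
      have sJ: "s \<in> J"
        using s interior_subset by blast
      have g: "(\<gamma> has_vector_derivative ?g) (at s)"
        using s sJ by (intro deriv) auto
      have "isCont \<psi> s"
        using br s by (auto simp: Phi_branch_along_def continuous_on_interior)
      moreover have "\<forall>\<^sub>F y in nhds s. \<psi> y \<in> Phi_values p (\<gamma> y)"
        using br s by (auto simp: Phi_branch_along_def eventually_nhds intro!: exI[of _ "interior J"]
            dest: interior_subset[THEN subsetD])
      \<comment> \<open>The parameters are frozen here: \<open>q\<close> is constant with derivative
        0, and only the point moves.\<close>
      ultimately have "(\<psi> has_derivative (\<lambda>x. \<psi> s * (snd (0::'n params) * \<gamma> s + snd p * (x *\<^sub>R ?g) -
          1 / 2 * (\<Sum>i\<in>UNIV. (x *\<^sub>R ?g - fst (0::'n params) $ i) / (\<gamma> s - fst p $ i))))) (at s)"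
        using g by (intro Phi_branch_has_derivative[where q = "\<lambda>_. p"])
          (auto simp: has_vector_derivative_def)
      then have \<psi>: "(\<psi> has_vector_derivative
          \<psi> s * (snd p - 1 / 2 * (\<Sum>j\<in>UNIV. 1 / (\<gamma> s - fst p $ j))) * ?g) (at s)"
        unfolding has_vector_derivative_def
        by (rule has_derivative_eq_rhs)
          (auto simp: fun_eq_iff scaleR_conv_of_real algebra_simps sum_distrib_left sum_divide_distrib)
      have hg: "((\<lambda>s. h (\<gamma> s)) has_vector_derivative ?g * h' (\<gamma> s)) (at s)"
        using field_vector_diff_chain_at[OF g h[OF sJ]] by (simp add: o_def)
      show ?thesis
        using has_vector_derivative_mult[OF \<psi> hg] by (rule has_vector_derivative_eq_rhs)
          (simp add: algebra_simps)
    qed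
  qed
qed

text \<open>The path and its velocity stay fixed while the parameters vary. In the new integrand,
  the first two terms in the numerator come from the branch, the third from the factor
  \<open>1 / (\<gamma> s - fst q $ i)\<close>. Continuity of the branch in the parameters suffices,
  since its derivative is then supplied by \<open>Phi_branch_has_derivative\<close>.\<close>

lemma Leibniz:
  assumes "open U" "convex U" "p \<in> U"
    and br: "\<And>q. q \<in> U \<Longrightarrow> Phi_branch_along q J \<gamma> (\<Psi> q)"
    and contU: "\<And>q s. q \<in> U \<Longrightarrow> s \<in> J \<Longrightarrow> isCont (\<lambda>q. \<Psi> q s) q"
  shows "((\<lambda>q. integral J (pulled_back_form q \<gamma> (\<Psi> q) i)) has_derivative
    (\<lambda>h. integral J (\<lambda>s. (snd h * \<gamma> s + 1 / 2 * (\<Sum>j\<in>UNIV. fst h $ j / (\<gamma> s - fst p $ j))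
         + fst h $ i / (\<gamma> s - fst p $ i)) / (\<gamma> s - fst p $ i) * \<Psi> p s * vector_derivative \<gamma> (at s)))) (at p)"
proof -
  define u where "u = (\<lambda>(q::'n params) (h::'n params) s. (snd h * \<gamma> s + 1 / 2 * (\<Sum>j\<in>UNIV. fst h $ j / (\<gamma> s - fst q $ j))
         + fst h $ i / (\<gamma> s - fst q $ i)) / (\<gamma> s - fst q $ i))"
  \<comment> \<open>The summands bound the three terms of the numerator of \<open>u\<close>, by
    \<open>growth\<close> and twice by \<open>sep\<close>; the last factor \<open>1 / d\<close>
    bounds the outer denominator.\<close>
  define K where "K = (B + 1 / 2 * (real CARD('n) * (1 / d)) + 1 / d) * (1 / d)"
  have "0 \<le> K"
    using pos by (auto simp: K_def)
  have ub: "norm (u q h s) \<le> (K * norm h) * (1 + \<bar>s\<bar>)" if "q \<in> U" "s \<in> J" for q h s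
  proof -
    let ?x = "norm h * (1 + \<bar>s\<bar>)"
    have h: "norm (fst h $ j) \<le> norm h" "norm (snd h) \<le> norm h" for j
      using Finite_Cartesian_Product.norm_nth_le[of "fst h" j] norm_fst_le[of "fst h" "snd h"] norm_snd_le[of "snd h" "fst h"] by auto
    have 0: "norm (fst h $ j / (\<gamma> s - fst q $ j)) \<le> norm h * (1 / d)" for j
      using mult_mono[OF h(1)[of j] norm_inverse_le[OF that, of j]] by (simp add: norm_divide)
    have le: "norm h * (1 / d) \<le> 1 / d * ?x"
      using pos mult_left_mono[of 1 "1 + \<bar>s\<bar>" "norm h"] by (simp add: divide_right_mono)
    have 1: "norm (snd h * \<gamma> s) \<le> B * ?x"
      using mult_mono[OF h(2) growth[OF that(2)]] by (simp add: norm_mult mult_ac)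
    have "norm (\<Sum>j\<in>UNIV. fst h $ j / (\<gamma> s - fst q $ j)) \<le> (\<Sum>j\<in>(UNIV::'n set). 1 / d * ?x)"
      by (intro sum_norm_le order_trans[OF 0 le])
    then have 2: "norm (1 / 2 * (\<Sum>j\<in>UNIV. fst h $ j / (\<gamma> s - fst q $ j))) \<le> 1 / 2 * (real CARD('n) * (1 / d * ?x))"
      by (simp only: norm_mult) simp
    define N where "N = snd h * \<gamma> s + 1 / 2 * (\<Sum>j\<in>UNIV. fst h $ j / (\<gamma> s - fst q $ j))
         + fst h $ i / (\<gamma> s - fst q $ i)"
    define C where "C = B + 1 / 2 * (real CARD('n) * (1 / d)) + 1 / d"
    have "norm N \<le> B * ?x + 1 / 2 * (real CARD('n) * (1 / d * ?x)) + 1 / d * ?x"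
      unfolding N_def by (intro norm_triangle_le add_mono 1 2 order_trans[OF 0 le])
    also have "\<dots> = C * ?x"
      unfolding C_def by (simp only: distrib_right mult.assoc)
    finally have "norm N * norm (1 / (\<gamma> s - fst q $ i)) \<le> (C * ?x) * (1 / d)"
      by (intro mult_mono norm_inverse_le that) (use pos in \<open>auto simp: C_def\<close>)
    moreover have "norm (u q h s) = norm N * norm (1 / (\<gamma> s - fst q $ i))"
      unfolding u_def N_def[symmetric] by (simp add: norm_divide)
    ultimately show ?thesis
      unfolding K_def C_def[symmetric] by (simp add: mult_ac)
  qed
  have uc: "continuous_on J (u q h)" if "q \<in> U" for q h
    unfolding u_def using singular_point_avoided[OF that] by (intro continuous_intros cont) auto
  \<comment> \<open>Differentiation takes place over \<open>J - P\<close>, where the velocity bound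
    holds at every point; this equality brings back \<open>J\<close>.\<close>
  have eq: "integral (J - P) f = integral J f" for f :: "real \<Rightarrow> complex"
    by (rule integral_spike_set) (auto intro: negligible_subset[OF negligible_finite[OF finite_P]])
  have form: "pulled_back_form q \<gamma> (\<Psi> q) i = (\<lambda>s. 1 / (\<gamma> s - fst q $ i) * \<Psi> q s * vector_derivative \<gamma> (at s))" for q
    by (intro ext) (simp add: pulled_back_form_def)
  have "((\<lambda>q. integral (J - P) (pulled_back_form q \<gamma> (\<Psi> q) i)) has_derivative
    (\<lambda>h. integral (J - P) (\<lambda>s. u p h s * \<Psi> p s * vector_derivative \<gamma> (at s)))) (at p)"
  proof (rule has_derivative_integral_dominated[OF assms(1-3),
        where B = "\<lambda>s. K * moment_const * exp (- (\<eta> / 2) * \<bar>s\<bar>)"])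
    show "pulled_back_form q \<gamma> (\<Psi> q) i integrable_on J - P" if "q \<in> U" for q
      unfolding form
    proof (rule moment_integrable(1)[OF that br[OF that], of "1 / d"])
      show "norm (1 / (\<gamma> s - fst q $ i)) \<le> 1 / d * (1 + \<bar>s\<bar>)" if "s \<in> J" for s
        using mult_left_mono[of 1 "1 + \<bar>s\<bar>" "1 / d"] norm_inverse_le[OF \<open>q \<in> U\<close> that, of i] pos by simp
    qed (use pos continuous_on_inverse_diff[OF that] in auto)
    show "(\<lambda>s. u p h s * \<Psi> p s * vector_derivative \<gamma> (at s)) integrable_on J - P" for h
      using \<open>0 \<le> K\<close> by (intro moment_integrable(1)[OF \<open>p \<in> U\<close> br[OF \<open>p \<in> U\<close>] _ uc ub] assms(3)) auto
    show "norm (u q h s * \<Psi> q s * vector_derivative \<gamma> (at s))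
        \<le> K * moment_const * exp (- (\<eta> / 2) * \<bar>s\<bar>) * norm h" if "q \<in> U" "s \<in> J - P" for q s h
      using moment_bound[OF that(1) br[OF that(1)] that(2) _ ub[OF that(1)], of h] that \<open>0 \<le> K\<close>
      by (simp add: mult_ac)
    show "(\<lambda>s. K * moment_const * exp (- (\<eta> / 2) * \<bar>s\<bar>)) integrable_on J - P"
      using pos J(2) finite_P
      by (intro integrable_on_mult_right integrable_exp_minus_abs sets.Diff)
        (auto intro: borel_closed dest: finite_imp_closed)
    show "((\<lambda>q. pulled_back_form q \<gamma> (\<Psi> q) i s) has_derivative
        (\<lambda>h. u q h s * \<Psi> q s * vector_derivative \<gamma> (at s))) (at q)" if q: "q \<in> U" and "s \<in> J - P" for q s
    proof -
      have s: "s \<in> J"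
        using that by blast
      have "\<forall>\<^sub>F q in nhds q. \<Psi> q s \<in> Phi_values q (\<gamma> s)"
        using eventually_nhds_in_open[OF assms(1) q]
        by eventually_elim (use br s in \<open>auto simp: Phi_branch_along_def\<close>)
      then have \<Psi>: "((\<lambda>q. \<Psi> q s) has_derivative (\<lambda>h. \<Psi> q s * (snd h * \<gamma> s + snd q * 0
           - 1 / 2 * (\<Sum>i\<in>UNIV. (0 - fst h $ i) / (\<gamma> s - fst q $ i))))) (at q)"
        by (rule Phi_branch_has_derivative[OF _ contU[OF q s]]) auto
      have "((\<lambda>q. \<gamma> s - fst q $ i) has_derivative (\<lambda>h. 0 - fst h $ i)) (at q)"
        by (intro has_derivative_diff has_derivative_const
            bounded_linear.has_derivative[OF bounded_linear_vec_nth] has_derivative_fst has_derivative_ident)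
      then have inv: "((\<lambda>q. inverse (\<gamma> s - fst q $ i)) has_derivative
          (\<lambda>h. - (inverse (\<gamma> s - fst q $ i) * (0 - fst h $ i) * inverse (\<gamma> s - fst q $ i)))) (at q)"
        using singular_point_avoided[OF q s] by (intro Deriv.has_derivative_inverse) auto
      have "((\<lambda>q. \<Psi> q s * inverse (\<gamma> s - fst q $ i) * vector_derivative \<gamma> (at s)) has_derivative
         (\<lambda>h. (\<Psi> q s * - (inverse (\<gamma> s - fst q $ i) * (0 - fst h $ i) * inverse (\<gamma> s - fst q $ i))
         + \<Psi> q s * (snd h * \<gamma> s + snd q * 0
           - 1 / 2 * (\<Sum>i\<in>UNIV. (0 - fst h $ i) / (\<gamma> s - fst q $ i))) * inverse (\<gamma> s - fst q $ i))
         * vector_derivative \<gamma> (at s))) (at q)"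
        by (rule has_derivative_mult_left[OF has_derivative_mult[OF \<Psi> inv]])
      then show ?thesis
        unfolding pulled_back_form_def divide_inverse[of "\<Psi> _ s"]
        by (rule has_derivative_eq_rhs)
          (auto simp: u_def fun_eq_iff sum_negf divide_inverse[of _ "\<gamma> s - fst q $ i"] algebra_simps)
    qed
  qed
  then show ?thesis
    by (simp add: eq u_def)
qed

end

section \<open>Estimates for admissible paths\<close>

text \<open>A negative real part is an open condition on \<open>l\<close>, which gives decay uniform
  in a ball. Writing the ray with \<open>\<bar>s - T\<bar>\<close> covers both ends of a path at
  once.\<close>

lemma ray_estimates:
  fixes a v l0 :: complex and T :: real
  assumes "Re (l0 * v) < 0"
  obtains r \<eta> A where "0 < r" "0 < \<eta>" "0 \<le> A" "norm v \<le> A"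
    "\<And>s l. l \<in> ball l0 r \<Longrightarrow> Re (l * (a + of_real \<bar>s - T\<bar> * v)) \<le> A - \<eta> * \<bar>s\<bar>"
    "\<And>s. norm (a + of_real \<bar>s - T\<bar> * v) \<le> A * (1 + \<bar>s\<bar>)"
proof -
  define q where "q = - Re (l0 * v)"
  \<comment> \<open>The cap 1 yields \<open>norm l \<le> norm l0 + 1\<close>; the other bound lets
    \<open>Re (l * v)\<close> change by at most \<open>q / 2\<close>, half of its original
    size.\<close>
  define r where "r = min 1 (q / (2 * norm v))"
  \<comment> \<open>The term \<open>\<bar>T\<bar> * (q / 2)\<close> is the price of replacing
    \<open>\<bar>s - T\<bar>\<close> by \<open>\<bar>s\<bar>\<close> in the decay; the last three
    terms are for the linear growth.\<close>
  define A where "A = (norm l0 + 1) * norm a + \<bar>T\<bar> * (q / 2) + norm a + \<bar>T\<bar> * norm v + norm v"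
  have v: "0 < norm v" and q: "0 < q"
    using assms by (auto simp: q_def)
  show ?thesis
  proof (rule that)
    show "0 < r" "0 < q / 2"
      using v q by (auto simp: r_def)
    show "0 \<le> A" "norm v \<le> A"
      using q by (auto simp: A_def)
    fix s
    have x: "\<bar>s\<bar> - \<bar>T\<bar> \<le> \<bar>s - T\<bar>" "\<bar>s - T\<bar> \<le> \<bar>s\<bar> + \<bar>T\<bar>"
      by auto
    show "Re (l * (a + of_real \<bar>s - T\<bar> * v)) \<le> A - q / 2 * \<bar>s\<bar>" if "l \<in> ball l0 r" for l
    proof -
      have d: "norm (l - l0) < r"
        using that by (simp add: dist_norm norm_minus_commute)
      have "Re ((l - l0) * v) \<le> norm (l - l0) * norm v"
        using complex_Re_le_cmod[of "(l - l0) * v"] by (simp add: norm_mult)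
      also have "\<dots> \<le> q / (2 * norm v) * norm v"
        using d by (intro mult_right_mono) (auto simp: r_def)
      also have "\<dots> = q / 2"
        using v by simp
      finally have "Re (l * v) - Re (l0 * v) \<le> q / 2"
        by (simp add: left_diff_distrib)
      then have lv: "Re (l * v) \<le> - (q / 2)"
        unfolding q_def by linarith
      have "Re (l * a) \<le> norm l * norm a"
        using complex_Re_le_cmod[of "l * a"] by (simp add: norm_mult)
      also have "\<dots> \<le> (norm l0 + 1) * norm a"
        using d norm_triangle_sub[of l l0] by (intro mult_right_mono) (auto simp: r_def)
      finally have la: "Re (l * a) \<le> (norm l0 + 1) * norm a" .
      have "Re (l * (a + of_real \<bar>s - T\<bar> * v)) = Re (l * a) + \<bar>s - T\<bar> * Re (l * v)"
        by (simp add: algebra_simps)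
      also have "\<dots> \<le> (norm l0 + 1) * norm a + \<bar>s - T\<bar> * (- (q / 2))"
        by (intro add_mono la mult_left_mono lv) simp
      also have "\<dots> \<le> (norm l0 + 1) * norm a - (\<bar>s\<bar> - \<bar>T\<bar>) * (q / 2)"
        using x(1) q mult_right_mono[OF x(1), of "q / 2"] by simp
      also have "\<dots> = (norm l0 + 1) * norm a + \<bar>T\<bar> * (q / 2) - q / 2 * \<bar>s\<bar>"
        by (simp add: field_simps)
      also have "\<dots> \<le> A - q / 2 * \<bar>s\<bar>"
        by (simp add: A_def)
      finally show ?thesis .
    qed
    have "norm (a + of_real \<bar>s - T\<bar> * v) \<le> norm a + \<bar>s - T\<bar> * norm v"
      using norm_triangle_ineq[of a "of_real \<bar>s - T\<bar> * v"] by (simp add: norm_mult)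
    also have "\<dots> \<le> norm a + (\<bar>s\<bar> + \<bar>T\<bar>) * norm v"
      using x(2) by (intro add_left_mono mult_right_mono) auto
    also have "\<dots> \<le> A + norm v * \<bar>s\<bar>"
      using q by (simp add: A_def algebra_simps)
    also have "\<dots> \<le> A + A * \<bar>s\<bar>"
      using q by (intro add_left_mono mult_right_mono) (auto simp: A_def)
    finally show "norm (a + of_real \<bar>s - T\<bar> * v) \<le> A * (1 + \<bar>s\<bar>)"
      by (simp add: algebra_simps)
  qed
qed

text \<open>\<open>E\<close> is the part of the parameter interval that runs along one ray. Allowing
  it to be empty lets finite ends be treated like infinite ones.\<close>

definition end_estimate :: "complex \<Rightarrow> (real \<Rightarrow> complex) \<Rightarrow> real set \<Rightarrow> real \<Rightarrow> real \<Rightarrow> real \<Rightarrow> bool" where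
  "end_estimate l0 \<gamma> E r \<eta> A \<longleftrightarrow> 0 < r \<and> 0 < \<eta> \<and> 0 \<le> A \<and>
     (\<forall>s\<in>E. (\<forall>l\<in>ball l0 r. Re (l * \<gamma> s) \<le> A - \<eta> * \<bar>s\<bar>) \<and> norm (\<gamma> s) \<le> A * (1 + \<bar>s\<bar>) \<and>
       norm (vector_derivative \<gamma> (at s)) \<le> A)"

lemma end_estimate_empty: "end_estimate l0 \<gamma> {} 1 1 0"
  by (simp add: end_estimate_def)

text \<open>The half-line is open because the path may have a corner at \<open>T\<close>; beyond it
  the velocity is the constant \<open>v\<close>.\<close>

lemma end_estimate_above:
  assumes "Re (l0 * v) < 0" and ray: "\<forall>s\<ge>T. \<gamma> s = \<gamma> T + of_real (s - T) * v"
  shows "\<exists>r \<eta> A. end_estimate l0 \<gamma> {T<..} r \<eta> A"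
proof -
  obtain r \<eta> A where A: "0 < r" "0 < \<eta>" "0 \<le> A" "norm v \<le> A"
    "\<And>s l. l \<in> ball l0 r \<Longrightarrow> Re (l * (\<gamma> T + of_real \<bar>s - T\<bar> * v)) \<le> A - \<eta> * \<bar>s\<bar>"
    "\<And>s. norm (\<gamma> T + of_real \<bar>s - T\<bar> * v) \<le> A * (1 + \<bar>s\<bar>)"
    using ray_estimates[OF assms(1), of "\<gamma> T" T] by metis
  have eq: "\<gamma> s = \<gamma> T + of_real \<bar>s - T\<bar> * v" if "s \<in> {T<..}" for s
    using ray[rule_format, of s] that by simp
  have "vector_derivative \<gamma> (at s) = v" if "s \<in> {T<..}" for s
  proof (rule vector_derivative_at)
    have "((\<lambda>s. \<gamma> T + of_real (s - T) * v) has_vector_derivative v) (at s)"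
      by (auto intro!: derivative_eq_intros)
    then show "(\<gamma> has_vector_derivative v) (at s)"
    proof (rule has_vector_derivative_transform_within_open[where S = "{T<..}"])
      show "\<gamma> T + of_real (y - T) * v = \<gamma> y" if "y \<in> {T<..}" for y
        using ray[rule_format, of y] that by simp
    qed (use that in auto)
  qed
  then have "end_estimate l0 \<gamma> {T<..} r \<eta> A"
    unfolding end_estimate_def using A(4)
    by (intro conjI ballI A(1-3)) (simp_all only: eq A(5,6) norm_minus_cancel)
  then show ?thesis by blast
qed

text \<open>Here infinity is reached as \<open>s\<close> decreases, so the velocity is
  \<open>- v\<close>.\<close>

lemma end_estimate_below:
  assumes "Re (l0 * v) < 0" and ray: "\<forall>s\<le>T. \<gamma> s = \<gamma> T + of_real (T - s) * v"
  shows "\<exists>r \<eta> A. end_estimate l0 \<gamma> {..<T} r \<eta> A"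
proof -
  obtain r \<eta> A where A: "0 < r" "0 < \<eta>" "0 \<le> A" "norm v \<le> A"
    "\<And>s l. l \<in> ball l0 r \<Longrightarrow> Re (l * (\<gamma> T + of_real \<bar>s - T\<bar> * v)) \<le> A - \<eta> * \<bar>s\<bar>"
    "\<And>s. norm (\<gamma> T + of_real \<bar>s - T\<bar> * v) \<le> A * (1 + \<bar>s\<bar>)"
    using ray_estimates[OF assms(1), of "\<gamma> T" T] by metis
  have eq: "\<gamma> s = \<gamma> T + of_real \<bar>s - T\<bar> * v" if "s \<in> {..<T}" for s
    using ray[rule_format, of s] that by simp
  have "vector_derivative \<gamma> (at s) = - v" if "s \<in> {..<T}" for s
  proof (rule vector_derivative_at)
    have "((\<lambda>s. \<gamma> T + of_real (T - s) * v) has_vector_derivative - v) (at s)"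
      by (auto intro!: derivative_eq_intros)
    then show "(\<gamma> has_vector_derivative - v) (at s)"
    proof (rule has_vector_derivative_transform_within_open[where S = "{..<T}"])
      show "\<gamma> T + of_real (T - y) * v = \<gamma> y" if "y \<in> {..<T}" for y
        using ray[rule_format, of y] that by simp
    qed (use that in auto)
  qed
  then have "end_estimate l0 \<gamma> {..<T} r \<eta> A"
    unfolding end_estimate_def using A(4)
    by (intro conjI ballI A(1-3)) (simp_all only: eq A(5,6) norm_minus_cancel)
  then show ?thesis by blast
qed

section \<open>Bounded velocity of piecewise smooth paths\<close>

lemma vector_derivative_of_closed_interval:
  assumes "\<forall>s\<in>{a..b}. (\<gamma> has_vector_derivative D s) (at s within {a..b})" "a < s" "s < b"
  shows "(\<gamma> has_vector_derivative vector_derivative \<gamma> (at s)) (at s)" "vector_derivative \<gamma> (at s) = D s"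
proof -
  have "(\<gamma> has_vector_derivative D s) (at s within {a..b})"
    using assms by simp
  then have "(\<gamma> has_vector_derivative D s) (at s within {a<..<b})"
    by (rule has_vector_derivative_within_subset) auto
  then have D: "(\<gamma> has_vector_derivative D s) (at s)"
    using at_within_open[of s "{a<..<b}"] assms(2,3) by simp
  then show "vector_derivative \<gamma> (at s) = D s"
    by (rule vector_derivative_at)
  with D show "(\<gamma> has_vector_derivative vector_derivative \<gamma> (at s)) (at s)"
    by simp
qed

text \<open>This is where one-sided derivatives at the break points pay off: \<open>D\<close> is
  continuous on the closed interval, hence bounded.\<close>

lemma bounded_derivative_between:
  assumes C1: "\<And>a b. a < b \<Longrightarrow> {a..b} \<subseteq> J \<Longrightarrow> {a<..<b} \<inter> P = {} \<Longrightarrow>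
      \<exists>D. continuous_on {a..b} D \<and> (\<forall>s\<in>{a..b}. (\<gamma> has_vector_derivative D s) (at s within {a..b}))"
    and "a < b" "{a..b} \<subseteq> J" "{a<..<b} \<inter> P = {}"
  shows "\<exists>M. \<forall>s\<in>{a<..<b}. norm (vector_derivative \<gamma> (at s)) \<le> M"
proof -
  obtain D where D: "continuous_on {a..b} D" "\<forall>s\<in>{a..b}. (\<gamma> has_vector_derivative D s) (at s within {a..b})"
    using C1[OF assms(2-4)] by blast
  have "bounded (D ` {a..b})"
    by (intro compact_imp_bounded compact_continuous_image D) simp
  then obtain M where "\<forall>s\<in>{a..b}. norm (D s) \<le> M"
    by (auto simp: bounded_iff)
  then show ?thesis
    using vector_derivative_of_closed_interval(2)[OF D(2)] by (intro exI[of _ M]) auto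
qed

text \<open>By the bisection principle it suffices to bound the velocity near each point
  \<open>x\<close>. As there are finitely many break points, a punctured neighbourhood of
  \<open>x\<close> contains none, and each half of it falls under
  \<open>bounded_derivative_between\<close>.\<close>

lemma piecewise_C1_derivative_bounded:
  assumes C1: "\<And>a b. a < b \<Longrightarrow> {a..b} \<subseteq> J \<Longrightarrow> {a<..<b} \<inter> P = {} \<Longrightarrow>
      \<exists>D. continuous_on {a..b} D \<and> (\<forall>s\<in>{a..b}. (\<gamma> has_vector_derivative D s) (at s within {a..b}))"
    and "finite P" "a \<le> b" "{a..b} \<subseteq> J"
  shows "\<exists>M. \<forall>s\<in>{a..b}. norm (vector_derivative \<gamma> (at s)) \<le> M"
proof -
  let ?bdd = "\<lambda>I. \<exists>M. \<forall>s\<in>I. norm (vector_derivative \<gamma> (at s)) \<le> M"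
  have Un: "?bdd (I \<union> K)" if "?bdd I" "?bdd K" for I K
  proof -
    from that obtain M M' where "\<forall>s\<in>I. norm (vector_derivative \<gamma> (at s)) \<le> M"
      "\<forall>s\<in>K. norm (vector_derivative \<gamma> (at s)) \<le> M'" by blast
    then show ?thesis
      by (intro exI[of _ "max M M'"]) (auto simp: le_max_iff_disj)
  qed
  have mono: "?bdd I" if "?bdd K" "I \<subseteq> K" for I K
    using that by blast
  have "?bdd ({a..b} \<inter> {a..b})"
    using \<open>a \<le> b\<close>
  proof (induction rule: Bolzano[where P = "\<lambda>x y. ?bdd ({a..b} \<inter> {x..y})"])
    case (trans x y z)
    then show ?case
      by (intro mono[OF Un[OF trans(1,2)]]) auto
  next
    case (local x)
    obtain e where e: "e > 0" "\<And>y. y \<in> P \<Longrightarrow> y \<noteq> x \<Longrightarrow> e \<le> dist x y"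
      using finite_set_avoid[OF \<open>finite P\<close>, of x] by blast
    have left: "?bdd ({a..b} \<inter> {x - e<..<x})"
    proof (cases "a < x")
      case True
      have "?bdd {max a (x - e)<..<x}"
        using True local assms(4) e
        by (intro bounded_derivative_between[OF C1]) (force simp: dist_real_def)+
      \<comment> \<open>At a single point \<open>vector_derivative\<close> has some value, even
        where no derivative exists, so adding a point cannot destroy boundedness.\<close>
      then have "?bdd ({max a (x - e)<..<x} \<union> {a})"
        by (rule Un) auto
      then show ?thesis
        by (rule mono) auto
    qed auto
    have right: "?bdd ({a..b} \<inter> {x<..<x + e})"
    proof (cases "x < b")
      case True
      have "?bdd {x<..<min b (x + e)}"
        using True local assms(4) e
        by (intro bounded_derivative_between[OF C1]) (force simp: dist_real_def)+
      then have "?bdd ({x<..<min b (x + e)} \<union> {b})"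
        by (rule Un) auto
      then show ?thesis
        by (rule mono) auto
    qed auto
    have "?bdd ({a..b} \<inter> {x - e<..<x} \<union> ({a..b} \<inter> {x<..<x + e} \<union> {x}))"
      by (intro Un left right) auto
    then have "?bdd ({a..b} \<inter> {y..z})" if "y \<le> x" "x \<le> z" "z - y < e" for y z
      by (rule mono) (use that in auto)
    then show ?case
      using e(1) by blast
  qed
  then show ?thesis by simp
qed

lemma is_interval_contains_Icc:
  fixes J :: "real set"
  assumes "is_interval J" "a \<in> J" "b \<in> J"
  shows "{a..b} \<subseteq> J"
  using assms by (meson atLeastAtMost_iff is_interval_1 subsetI)

text \<open>Since \<open>J\<close> may be unbounded, compactness alone does not separate
  \<open>a\<close> from the path. Within distance 1 of \<open>a\<close> the real part of
  \<open>l * \<gamma> s\<close> is at least \<open>- (norm l * (1 + norm a))\<close>, and by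
  \<open>decay\<close> this is impossible for \<open>\<bar>s\<bar> > S\<close>. What remains is a
  compact piece.\<close>

lemma distance_from_path:
  fixes \<gamma> :: "real \<Rightarrow> complex"
  assumes "closed J" "continuous_on J \<gamma>" "\<forall>s\<in>J. \<gamma> s \<noteq> a" "0 < \<eta>"
    and decay: "\<And>s. s \<in> J \<Longrightarrow> Re (l * \<gamma> s) \<le> B - \<eta> * \<bar>s\<bar>"
  shows "\<exists>d>0. \<forall>s\<in>J. d \<le> norm (\<gamma> s - a)"
proof -
  define S where "S = (\<bar>B\<bar> + norm l * (1 + norm a)) / \<eta>"
  have far: "1 \<le> norm (\<gamma> s - a) \<or> \<bar>s\<bar> \<le> S" if "s \<in> J" for s
  proof (rule ccontr)
    assume "\<not> ?thesis"
    then have n: "norm (\<gamma> s - a) < 1" "S < \<bar>s\<bar>" by auto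
    then have "norm (\<gamma> s) \<le> 1 + norm a"
      using norm_triangle_sub[of "\<gamma> s" a] by simp
    then have "norm (l * \<gamma> s) \<le> norm l * (1 + norm a)"
      by (simp add: norm_mult mult_left_mono)
    then have "- (norm l * (1 + norm a)) \<le> Re (l * \<gamma> s)"
      using abs_Re_le_cmod[of "l * \<gamma> s"] by linarith
    with decay[OF that] have "\<eta> * \<bar>s\<bar> \<le> \<bar>B\<bar> + norm l * (1 + norm a)"
      by linarith
    then have "\<bar>s\<bar> \<le> S"
      using \<open>0 < \<eta>\<close> by (simp add: S_def field_simps)
    with n show False by simp
  qed
  have "compact (\<gamma> ` (J \<inter> {- S..S}))"
    using assms(1,2) by (intro compact_continuous_image closed_Int_compact)
      (auto intro: continuous_on_subset)
  then obtain d where d: "d > 0" "\<forall>x\<in>\<gamma> ` (J \<inter> {- S..S}). d \<le> dist a x"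
    using separate_point_closed[of "\<gamma> ` (J \<inter> {- S..S})" a] assms(3) compact_imp_closed by blast
  show ?thesis
  proof (intro exI[of _ "min 1 d"] conjI ballI)
    fix s assume s: "s \<in> J"
    show "min 1 d \<le> norm (\<gamma> s - a)"
    proof (cases "\<bar>s\<bar> \<le> S")
      case True
      then have "d \<le> dist a (\<gamma> s)"
        using d(2) s by (auto simp: abs_le_iff)
      then show ?thesis
        by (simp add: dist_norm norm_minus_commute min_le_iff_disj)
    qed (use far[OF s] in \<open>auto simp: min_le_iff_disj\<close>)
  qed (use d in simp)
qed

lemma tame_path_mono: "tame_path U J \<gamma> P B \<eta> d \<Longrightarrow> V \<subseteq> U \<Longrightarrow> tame_path V J \<gamma> P B \<eta> d"
  unfolding tame_path_def by blast

lemma fst_snd_ball: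
  assumes "p \<in> ball p0 r"
  shows "fst p \<in> ball (fst p0) r" "snd p \<in> ball (snd p0) r"
  using assms dist_fst_le[of p0 p] dist_snd_le[of p0 p] by auto

text \<open>Along the rays explicit formulas give bounds uniform in \<open>l\<close>; the rest of
  the path is compact, where continuity and bounded velocity suffice.\<close>

lemma admissible_path_tame:
  fixes p0 :: "'n::finite params"
  assumes adm: "admissible_path p0 J \<gamma>"
  shows "\<exists>r>0. \<exists>P B \<eta> d. tame_path (ball p0 r) J \<gamma> P B \<eta> d"
proof -
  let ?l0 = "snd p0"
  have J: "is_interval J" "closed J" "J \<noteq> {}" and cont: "continuous_on J \<gamma>"
    and avoid: "\<forall>s\<in>J. \<forall>i. \<gamma> s \<noteq> fst p0 $ i"
    using adm by (auto simp: admissible_path_def piecewise_smooth_on_def)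
  have "piecewise_smooth_on \<gamma> J"
    using adm by (simp add: admissible_path_def)
  then obtain P0 where P0: "finite P0" and C1': "\<forall>a b. a < b \<and> {a..b} \<subseteq> J \<and> {a<..<b} \<inter> P0 = {} \<longrightarrow>
      (\<exists>D. continuous_on {a..b} D \<and> (\<forall>s\<in>{a..b}. (\<gamma> has_vector_derivative D s) (at s within {a..b})))"
    unfolding piecewise_smooth_on_def by (elim conjE exE)
  have C1: "\<exists>D. continuous_on {a..b} D \<and> (\<forall>s\<in>{a..b}. (\<gamma> has_vector_derivative D s) (at s within {a..b}))"
    if "a < b" "{a..b} \<subseteq> J" "{a<..<b} \<inter> P0 = {}" for a b
    using that by (intro C1'[rule_format] conjI)
  have above: "\<not> bdd_above J \<longrightarrow> (\<exists>T v. Re (?l0 * v) < 0 \<and> T \<in> J \<and> (\<forall>s\<ge>T. \<gamma> s = \<gamma> T + of_real (s - T) * v))"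
    and below: "\<not> bdd_below J \<longrightarrow> (\<exists>T v. Re (?l0 * v) < 0 \<and> T \<in> J \<and> (\<forall>s\<le>T. \<gamma> s = \<gamma> T + of_real (T - s) * v))"
    using adm unfolding admissible_path_def by argo+
  have "\<exists>T\<in>J. \<exists>r \<eta> A. end_estimate ?l0 \<gamma> (J \<inter> {T<..}) r \<eta> A"
  proof (cases "bdd_above J")
    case True
    then have "J \<inter> {Sup J<..} = {}"
      by (auto dest: cSup_upper)
    then show ?thesis
      using True J end_estimate_empty by (metis closed_contains_Sup)
  next
    case False
    then obtain T v where T: "T \<in> J" "Re (?l0 * v) < 0" "\<forall>s\<ge>T. \<gamma> s = \<gamma> T + of_real (s - T) * v"
      using mp[OF above False] by (elim exE conjE)
    then obtain r \<eta> A where "end_estimate ?l0 \<gamma> {T<..} r \<eta> A"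
      using end_estimate_above by blast
    then have "end_estimate ?l0 \<gamma> (J \<inter> {T<..}) r \<eta> A"
      unfolding end_estimate_def by simp
    then show ?thesis
      using T(1) by blast
  qed
  then obtain T1 r1 \<eta>1 A1 where T1: "T1 \<in> J" "end_estimate ?l0 \<gamma> (J \<inter> {T1<..}) r1 \<eta>1 A1"
    by blast
  have "\<exists>T\<in>J. \<exists>r \<eta> A. end_estimate ?l0 \<gamma> (J \<inter> {..<T}) r \<eta> A"
  proof (cases "bdd_below J")
    case True
    then have "J \<inter> {..<Inf J} = {}"
      by (auto dest: cInf_lower)
    then show ?thesis
      using True J end_estimate_empty by (metis closed_contains_Inf)
  next
    case False
    then obtain T v where T: "T \<in> J" "Re (?l0 * v) < 0" "\<forall>s\<le>T. \<gamma> s = \<gamma> T + of_real (T - s) * v"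
      using mp[OF below False] by (elim exE conjE)
    then obtain r \<eta> A where "end_estimate ?l0 \<gamma> {..<T} r \<eta> A"
      using end_estimate_below by blast
    then have "end_estimate ?l0 \<gamma> (J \<inter> {..<T}) r \<eta> A"
      unfolding end_estimate_def by simp
    then show ?thesis
      using T(1) by blast
  qed
  then obtain T2 r2 \<eta>2 A2 where T2: "T2 \<in> J" "end_estimate ?l0 \<gamma> (J \<inter> {..<T2}) r2 \<eta>2 A2"
    by blast
  \<comment> \<open>No order between \<open>T1\<close> and \<open>T2\<close> has been established,
    so the compact middle is spanned by their minimum and maximum. It contains every parameter that
    lies on neither ray.\<close>
  define a where "a = min T1 T2"
  define b where "b = max T1 T2"
  have ab: "a \<le> b" "a \<in> J" "b \<in> J"
    using T1 T2 by (auto simp: a_def b_def min_def max_def)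
  then have sub: "{a..b} \<subseteq> J"
    by (intro is_interval_contains_Icc J(1))
  obtain M where M: "\<forall>s\<in>{a..b}. norm (vector_derivative \<gamma> (at s)) \<le> M"
    using piecewise_C1_derivative_bounded[OF C1 P0 ab(1) sub] by blast
  have "bounded (\<gamma> ` {a..b})"
    using cont sub by (intro compact_imp_bounded compact_continuous_image) (auto intro: continuous_on_subset)
  then obtain G where G: "\<forall>s\<in>{a..b}. norm (\<gamma> s) \<le> G"
    by (auto simp: bounded_iff)
  have nn: "0 \<le> G" "0 \<le> M"
    using G M ab(1) by (meson atLeastAtMost_iff norm_ge_zero order_refl order_trans)+
  define \<eta> where "\<eta> = min \<eta>1 \<eta>2"
  define S where "S = max \<bar>a\<bar> \<bar>b\<bar>"
  define r where "r = min 1 (min r1 r2)"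
  \<comment> \<open>A sum of nonnegative constants dominates each of them. The bracket handles the
    middle, where \<open>\<eta> * \<bar>s\<bar> \<le> \<eta> * S\<close> has to be compensated, and
    the final 1 makes \<open>B\<close> positive.\<close>
  define B where "B = A1 + A2 + ((norm ?l0 + 1) * G + \<eta> * S) + G + M + 1"
  note est = T1(2)[unfolded end_estimate_def] T2(2)[unfolded end_estimate_def]
  have pos: "0 < \<eta>" "0 < r" "0 \<le> A1" "0 \<le> A2" "0 \<le> \<eta> * S"
    using est by (auto simp: \<eta>_def r_def S_def)
  have B: "A1 \<le> B" "A2 \<le> B" "(norm ?l0 + 1) * G + \<eta> * S \<le> B" "G \<le> B" "M \<le> B" "0 < B"
    using pos nn unfolding B_def by (auto intro!: add_nonneg_nonneg add_pos_nonneg add_nonneg_pos add_increasing add_increasing2)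
  have main: "(\<forall>l\<in>ball ?l0 r. Re (l * \<gamma> s) \<le> B - \<eta> * \<bar>s\<bar>) \<and> norm (\<gamma> s) \<le> B * (1 + \<bar>s\<bar>) \<and>
      norm (vector_derivative \<gamma> (at s)) \<le> B" if s: "s \<in> J" for s
  proof -
    have outer: ?thesis if "end_estimate ?l0 \<gamma> E r' \<eta>' A'" "s \<in> E" "A' \<le> B" "r \<le> r'" "\<eta> \<le> \<eta>'" for E r' \<eta>' A'
    proof -
      have e: "\<And>l. l \<in> ball ?l0 r' \<Longrightarrow> Re (l * \<gamma> s) \<le> A' - \<eta>' * \<bar>s\<bar>"
        "norm (\<gamma> s) \<le> A' * (1 + \<bar>s\<bar>)" "norm (vector_derivative \<gamma> (at s)) \<le> A'"
        using that(1,2) unfolding end_estimate_def by blast+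
      have le: "\<eta> * \<bar>s\<bar> \<le> \<eta>' * \<bar>s\<bar>" "A' * (1 + \<bar>s\<bar>) \<le> B * (1 + \<bar>s\<bar>)"
        using that(3,5) by (auto intro!: mult_right_mono)
      have "Re (l * \<gamma> s) \<le> B - \<eta> * \<bar>s\<bar>" if "l \<in> ball ?l0 r" for l
      proof -
        have "l \<in> ball ?l0 r'"
          using that \<open>r \<le> r'\<close> by simp
        from e(1)[OF this] show ?thesis
          using le(1) \<open>A' \<le> B\<close> by linarith
      qed
      moreover have "norm (\<gamma> s) \<le> B * (1 + \<bar>s\<bar>)" "norm (vector_derivative \<gamma> (at s)) \<le> B"
        using e(2,3) le(2) \<open>A' \<le> B\<close> by linarith+
      ultimately show ?thesis
        by blast
    qed
    have "s \<in> {a..b}" if "\<not> s > T1" "\<not> s < T2"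
      using that by (simp add: a_def b_def min_le_iff_disj le_max_iff_disj)
    then consider "s > T1" | "s < T2" | "s \<in> {a..b}"
      by blast
    then show ?thesis
    proof cases
      case 1
      then show ?thesis
        using s B by (intro outer[OF T1(2)]) (auto simp: r_def \<eta>_def)
    next
      case 2
      then show ?thesis
        using s B by (intro outer[OF T2(2)]) (auto simp: r_def \<eta>_def)
    next
      case 3
      have "Re (l * \<gamma> s) \<le> B - \<eta> * \<bar>s\<bar>" if "l \<in> ball ?l0 r" for l
      proof -
        have "norm l \<le> norm ?l0 + 1"
          using that norm_triangle_sub[of l ?l0] by (auto simp: r_def dist_norm norm_minus_commute)
        then have "norm (l * \<gamma> s) \<le> (norm ?l0 + 1) * G"
          unfolding norm_mult using G 3 by (intro mult_mono) auto
        moreover have "\<eta> * \<bar>s\<bar> \<le> \<eta> * S"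
          using pos 3 by (intro mult_left_mono) (auto simp: S_def)
        ultimately show ?thesis
          using complex_Re_le_cmod[of "l * \<gamma> s"] B(3) by linarith
      qed
      moreover have "norm (\<gamma> s) \<le> B * (1 + \<bar>s\<bar>)"
      proof -
        have "norm (\<gamma> s) \<le> B * 1"
          using G 3 B by force
        also have "\<dots> \<le> B * (1 + \<bar>s\<bar>)"
          using B by (intro mult_left_mono) auto
        finally show ?thesis .
      qed
      moreover have "norm (vector_derivative \<gamma> (at s)) \<le> B"
        using M 3 B(5) by force
      ultimately show ?thesis by blast
    qed
  qed
  have "\<exists>d>0. \<forall>s\<in>J. d \<le> norm (\<gamma> s - fst p0 $ i)" for i
    using avoid main pos by (intro distance_from_path[OF J(2) cont, where l = ?l0 and B = B and \<eta> = \<eta>]) auto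
  then obtain d' where d': "\<And>i. d' i > 0" "\<And>i s. s \<in> J \<Longrightarrow> d' i \<le> norm (\<gamma> s - fst p0 $ i)"
    by metis
  \<comment> \<open>Half of the distance to the paths is kept in reserve: each singular point may
    move by less than \<open>d\<close> and still stays \<open>d\<close> away.\<close>
  define d where "d = Min (range d') / 2"
  have d: "0 < d" "\<And>i s. s \<in> J \<Longrightarrow> 2 * d \<le> norm (\<gamma> s - fst p0 $ i)"
  proof -
    show "0 < d"
      using d'(1) by (simp add: d_def)
    show "2 * d \<le> norm (\<gamma> s - fst p0 $ i)" if "s \<in> J" for i s
    proof -
      have "Min (range d') \<le> d' i"
        by (intro Min_le) auto
      then show ?thesis
        using d'(2)[OF that, of i] unfolding d_def by linarith
    qed
  qed
  \<comment> \<open>If \<open>J\<close> is unbounded, \<open>Sup J\<close> or \<open>Inf J\<close>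
    is an unspecified real; one more exceptional point does no harm.\<close>
  define P where "P = P0 \<union> {Sup J, Inf J}"
  \<comment> \<open>Off \<open>P\<close> a parameter is interior to \<open>J\<close> and at a
    positive distance from all break points, so a closed interval around it is free of them.\<close>
  have C1_nbhd: "\<exists>a b D. a < s \<and> s < b \<and> continuous_on {a..b} D \<and>
      (\<forall>s\<in>{a..b}. (\<gamma> has_vector_derivative D s) (at s within {a..b}))" if s: "s \<in> J - P" for s
  proof -
    have "\<exists>x\<in>J. x < s"
    proof (cases "bdd_below J")
      case True
      then have "Inf J \<in> J" "Inf J < s"
        using s J closed_contains_Inf[OF J(3)] cInf_lower[of s J] by (auto simp: P_def order_less_le)
      then show ?thesis by blast
    qed (auto simp: bdd_below_def not_le)
    then obtain x where x: "x \<in> J" "x < s" by blast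
    have "\<exists>y\<in>J. s < y"
    proof (cases "bdd_above J")
      case True
      then have "Sup J \<in> J" "s < Sup J"
        using s J closed_contains_Sup[OF J(3)] cSup_upper[of s J] by (auto simp: P_def order_less_le)
      then show ?thesis by blast
    qed (auto simp: bdd_above_def not_le)
    then obtain y where y: "y \<in> J" "s < y" by blast
    obtain e where e: "e > 0" "\<And>z. z \<in> P0 \<Longrightarrow> z \<noteq> s \<Longrightarrow> e \<le> dist s z"
      using finite_set_avoid[OF P0, of s] by blast
    let ?a = "max x (s - e)" and ?b = "min y (s + e)"
    have "{?a..?b} \<subseteq> J"
      using is_interval_contains_Icc[OF J(1) x(1) y(1)] by auto
    moreover have "{?a<..<?b} \<inter> P0 = {}"
      using e s by (force simp: P_def dist_real_def)
    ultimately obtain D where "continuous_on {?a..?b} D"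
      "\<forall>s\<in>{?a..?b}. (\<gamma> has_vector_derivative D s) (at s within {?a..?b})"
      using C1[of ?a ?b] x y e by auto
    then show ?thesis
      using x y e by (intro exI[of _ ?a] exI[of _ ?b] exI[of _ D]) auto
  qed
  have isCont_deriv: "isCont (\<lambda>s. vector_derivative \<gamma> (at s)) s" if s: "s \<in> J - P" for s
  proof -
    obtain a b D where D: "a < s" "s < b" "continuous_on {a..b} D"
      "\<forall>s\<in>{a..b}. (\<gamma> has_vector_derivative D s) (at s within {a..b})"
      using C1_nbhd[OF s] by blast
    have "continuous_on {a<..<b} D"
      using D(3) by (rule continuous_on_subset) auto
    then have "continuous_on {a<..<b} (\<lambda>s. vector_derivative \<gamma> (at s))"
      by (rule continuous_on_eq) (simp add: vector_derivative_of_closed_interval(2)[OF D(4)])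
    then show ?thesis
      using D(1,2) by (simp add: continuous_on_eq_continuous_at)
  qed
  have "tame_path (ball p0 (min r d)) J \<gamma> P B \<eta> d"
  proof
    show "finite P" using P0 by (simp add: P_def)
    show "continuous_on (J - P) (\<lambda>s. vector_derivative \<gamma> (at s))"
      using isCont_deriv by (intro continuous_at_imp_continuous_on) auto
    show "(\<gamma> has_vector_derivative vector_derivative \<gamma> (at s)) (at s)" if s: "s \<in> J - P" for s
      using C1_nbhd[OF s] vector_derivative_of_closed_interval(1) by metis
    show "Re (snd p * \<gamma> s) \<le> B - \<eta> * \<bar>s\<bar>" if "p \<in> ball p0 (min r d)" "s \<in> J" for p s
      using main[OF that(2)] fst_snd_ball(2)[OF that(1)] by simp
    show "d \<le> norm (\<gamma> s - fst p $ i)" if "p \<in> ball p0 (min r d)" "s \<in> J" for p s i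
    proof -
      have "norm (fst p $ i - fst p0 $ i) \<le> norm (fst p - fst p0)"
        using Finite_Cartesian_Product.norm_nth_le[of "fst p - fst p0" i] by simp
      also have "\<dots> < d"
        using fst_snd_ball(1)[OF that(1)] by (simp add: dist_norm norm_minus_commute)
      finally show ?thesis
        using d(2)[OF that(2), of i] norm_triangle_ineq[of "\<gamma> s - fst p $ i" "fst p $ i - fst p0 $ i"] by simp
    qed
  qed (use J cont pos B d main in auto)
  then show ?thesis
    using pos d(1) by (intro exI[of _ "min r d"]) auto
qed

section \<open>Continuation of branches and twisted cycles\<close>

text \<open>Since \<open>1 - (z - z0) / (t - z0) = (t - z) / (t - z0)\<close>, this is the quotient
  of \<Phi> at \<open>p\<close> by \<Phi> at \<open>p0\<close>, in the branch that equals 1 for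
  \<open>p = p0\<close>.\<close>

definition branch_factor :: "'n::finite params \<Rightarrow> 'n params \<Rightarrow> complex \<Rightarrow> complex" where
  "branch_factor p0 p t = exp ((snd p - snd p0) * t) *
     (\<Prod>i\<in>UNIV. inverse (csqrt (1 - (fst p $ i - fst p0 $ i) / (t - fst p0 $ i))))"

lemma branch_factor_self [simp]: "branch_factor p p t = 1"
  by (simp add: branch_factor_def)

text \<open>Keeps the argument of \<open>csqrt\<close> in \<open>branch_factor\<close> off the cut,
  by positivity of its real part.\<close>

lemma one_minus_quotient_not_nonpos:
  fixes a b :: complex
  assumes "norm a < norm b"
  shows "1 - a / b \<notin> \<real>\<^sub>\<le>\<^sub>0"
proof -
  have "norm (a / b) < 1"
    using assms by (auto simp: norm_divide divide_less_eq)
  then have "Re (a / b) < 1"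
    using complex_Re_le_cmod[of "a / b"] by linarith
  then show ?thesis
    by (auto simp: complex_nonpos_Reals_iff)
qed

lemma branch_factor_Phi_values:
  assumes v: "v \<in> Phi_values p0 t"
    and near: "\<And>i. norm (fst p $ i - fst p0 $ i) < norm (t - fst p0 $ i)"
  shows "v * branch_factor p0 p t \<in> Phi_values p t"
proof -
  obtain r where r: "v = exp (snd p0 * t) * (\<Prod>i\<in>UNIV. r i)" "\<And>i. (r i)\<^sup>2 * (t - fst p0 $ i) = 1"
    using v by (auto simp: Phi_values_def)
  define x where "x = (\<lambda>i. 1 - (fst p $ i - fst p0 $ i) / (t - fst p0 $ i))"
  define r' where "r' = (\<lambda>i. r i * inverse (csqrt (x i)))"
  have "(r' i)\<^sup>2 * (t - fst p $ i) = 1" for i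
  proof -
    have "x i \<noteq> 0"
      using one_minus_quotient_not_nonpos[OF near[of i]] unfolding x_def by (metis nonpos_Reals_zero_I)
    moreover have "t - fst p $ i = x i * (t - fst p0 $ i)"
      using Phi_values_nonzero(2)[OF v, of i] by (simp add: x_def field_simps)
    ultimately have "(r' i)\<^sup>2 * (t - fst p $ i) = (r i)\<^sup>2 * (t - fst p0 $ i)"
      by (simp add: r'_def power_mult_distrib power_inverse)
    then show ?thesis
      using r(2) by simp
  qed
  moreover have "v * branch_factor p0 p t = exp (snd p * t) * (\<Prod>i\<in>UNIV. r' i)"
    by (simp add: r(1) branch_factor_def r'_def x_def prod.distrib left_diff_distrib exp_diff)
  ultimately show ?thesis
    by (auto simp: Phi_values_def)
qed

lemma continuous_on_branch_factor_path:
  assumes "continuous_on J \<gamma>"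
    and near: "\<And>s i. s \<in> J \<Longrightarrow> norm (fst p $ i - fst p0 $ i) < norm (\<gamma> s - fst p0 $ i)"
  shows "continuous_on J (\<lambda>s. branch_factor p0 p (\<gamma> s))"
proof -
  have nz: "\<gamma> s - fst p0 $ i \<noteq> 0" if "s \<in> J" for s i
    using near[OF that, of i] by auto
  have x: "1 - (fst p $ i - fst p0 $ i) / (\<gamma> s - fst p0 $ i) \<in> - \<real>\<^sub>\<le>\<^sub>0" if "s \<in> J" for s i
    using one_minus_quotient_not_nonpos[OF near[OF that]] by simp
  have "continuous_on J (\<lambda>s. csqrt (1 - (fst p $ i - fst p0 $ i) / (\<gamma> s - fst p0 $ i)))" for i
    by (rule continuous_on_compose2[OF continuous_on_csqrt])
      (use x nz in \<open>auto intro!: continuous_intros assms(1)\<close>)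
  moreover have "csqrt (1 - (fst p $ i - fst p0 $ i) / (\<gamma> s - fst p0 $ i)) \<noteq> 0" if "s \<in> J" for s i
    using x[OF that, of i] by (metis ComplD csqrt_eq_0 nonpos_Reals_zero_I)
  ultimately show ?thesis
    unfolding branch_factor_def by (intro continuous_intros assms(1)) auto
qed

lemma isCont_branch_factor_params:
  assumes near: "\<And>i. norm (fst p $ i - fst p0 $ i) < norm (t - fst p0 $ i)"
  shows "isCont (\<lambda>p. branch_factor p0 p t) p"
proof -
  have nz: "t - fst p0 $ i \<noteq> 0" for i
    using near[of i] by auto
  have x: "1 - (fst p $ i - fst p0 $ i) / (t - fst p0 $ i) \<notin> \<real>\<^sub>\<le>\<^sub>0" for i
    by (rule one_minus_quotient_not_nonpos[OF near])
  have "isCont (\<lambda>p. csqrt (1 - (fst p $ i - fst p0 $ i) / (t - fst p0 $ i))) p" for i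
    using x nz by (intro isCont_csqrt' continuous_intros) auto
  moreover have "csqrt (1 - (fst p $ i - fst p0 $ i) / (t - fst p0 $ i)) \<noteq> 0" for i
    using x[of i] by (metis csqrt_eq_0 nonpos_Reals_zero_I)
  ultimately show ?thesis
    unfolding branch_factor_def by (intro continuous_intros) auto
qed

text \<open>A continuous branch has the derivative given by the logarithmic differential, and that
  formula is complex linear in the direction.\<close>

lemma branch_jointly_holomorphic:
  assumes "open U" and val: "\<And>p. p \<in> U \<Longrightarrow> \<psi> p \<in> Phi_values p t"
    and cont: "\<And>p. p \<in> U \<Longrightarrow> isCont \<psi> p"
  shows "jointly_holomorphic_on \<psi> U"
  unfolding jointly_holomorphic_on_def
proof (intro ballI exI conjI allI)
  fix p assume p: "p \<in> U"
  have "\<forall>\<^sub>F q in nhds p. \<psi> q \<in> Phi_values q t"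
    using eventually_nhds_in_open[OF assms(1) p] by eventually_elim (rule val)
  then show "(\<psi> has_derivative (\<lambda>h. \<psi> p * (snd h * t + snd p * 0
           - 1 / 2 * (\<Sum>i\<in>UNIV. (0 - fst h $ i) / (t - fst p $ i))))) (at p)"
    by (rule Phi_branch_has_derivative[OF _ cont[OF p]]) auto
  fix a v w
  show "\<psi> p * (snd (a *s v, a * w) * t + snd p * 0
           - 1 / 2 * (\<Sum>i\<in>UNIV. (0 - fst (a *s v, a * w) $ i) / (t - fst p $ i)))
      = a * (\<psi> p * (snd (v, w) * t + snd p * 0
           - 1 / 2 * (\<Sum>i\<in>UNIV. (0 - fst (v, w) $ i) / (t - fst p $ i))))"
    by (simp add: sum_negf sum_distrib_left algebra_simps)
qed

lemma jointly_holomorphic_on_isCont: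
  "jointly_holomorphic_on f U \<Longrightarrow> p \<in> U \<Longrightarrow> isCont f p"
  unfolding jointly_holomorphic_on_def using has_derivative_continuous by blast

text \<open>The squares agree, so the quotient of the two branches takes only the values 1 and -1;
  being continuous on a connected set, it is constant.\<close>

lemma branch_continuation_unique:
  assumes "connected U" "p0 \<in> U"
    and f: "continuous_on U f" "\<And>p. p \<in> U \<Longrightarrow> f p \<in> Phi_values p t"
    and g: "continuous_on U g" "\<And>p. p \<in> U \<Longrightarrow> g p \<in> Phi_values p t"
    and "f p0 = g p0" "p \<in> U"
  shows "f p = g p"
proof -
  have nz: "g q \<noteq> 0" if "q \<in> U" for q
    using Phi_values_nonzero(1)[OF g(2)[OF that]] .
  have "(f q)\<^sup>2 = (g q)\<^sup>2" if "q \<in> U" for q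
    using Phi_values_square[OF f(2)[OF that]] Phi_values_square[OF g(2)[OF that]] by simp
  then have "f q = g q \<or> f q = - g q" if "q \<in> U" for q
    using that by (simp add: power2_eq_iff)
  then have "f q / g q = 1 \<or> f q / g q = -1" if "q \<in> U" for q
    using nz[OF that] that by fastforce
  then have "(\<lambda>q. f q / g q) ` U \<subseteq> {1, -1}"
    by blast
  then have "finite ((\<lambda>q. f q / g q) ` U)"
    by (rule finite_subset) simp
  moreover have "continuous_on U (\<lambda>q. f q / g q)"
    using f(1) g(1) nz by (intro continuous_intros) auto
  ultimately have "(\<lambda>q. f q / g q) constant_on U"
    using assms(1) by (intro continuous_finite_range_constant)
  then have "f p / g p = f p0 / g p0"
    using assms(2,8) unfolding constant_on_def by metis
  then show ?thesis
    using assms(2,7,8) nz by simp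
qed

text \<open>Grouping the end points by their position \<open>t\<close> turns the sum into that of
  \<open>w t\<close> times the boundary at \<open>t\<close>, over the finite set \<open>T\<close> of
  positions. The weight later absorbs both the continuation factor and the function \<open>h\<close>
  of \<open>Stokes\<close>.\<close>

lemma twisted_boundary_weighted:
  assumes "\<And>t. twisted_boundary m c J \<gamma> \<phi> t = 0"
  shows "(\<Sum>k<m. c k * ((if bdd_above (J k) then \<phi> k (Sup (J k)) * w (\<gamma> k (Sup (J k))) else 0) -
     (if bdd_below (J k) then \<phi> k (Inf (J k)) * w (\<gamma> k (Inf (J k))) else 0))) = (0::complex)"
proof -
  let ?A = "{k \<in> {..<m}. bdd_above (J k)}" and ?B = "{k \<in> {..<m}. bdd_below (J k)}"
  define T where "T = (\<lambda>k. \<gamma> k (Sup (J k))) ` ?A \<union> (\<lambda>k. \<gamma> k (Inf (J k))) ` ?B"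
  have T: "finite T"
    by (simp add: T_def)
  have A: "(\<Sum>k\<in>?A. c k * \<phi> k (Sup (J k)) * w (\<gamma> k (Sup (J k)))) =
      (\<Sum>t\<in>T. w t * (\<Sum>k | k < m \<and> bdd_above (J k) \<and> \<gamma> k (Sup (J k)) = t. c k * \<phi> k (Sup (J k))))"
    by (subst sum.group[of ?A T "\<lambda>k. \<gamma> k (Sup (J k))", symmetric])
      (auto simp: T_def sum_distrib_left mult_ac intro!: sum.cong)
  have B: "(\<Sum>k\<in>?B. c k * \<phi> k (Inf (J k)) * w (\<gamma> k (Inf (J k)))) =
      (\<Sum>t\<in>T. w t * (\<Sum>k | k < m \<and> bdd_below (J k) \<and> \<gamma> k (Inf (J k)) = t. c k * \<phi> k (Inf (J k))))"
    by (subst sum.group[of ?B T "\<lambda>k. \<gamma> k (Inf (J k))", symmetric])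
      (auto simp: T_def sum_distrib_left mult_ac intro!: sum.cong)
  have "(\<Sum>k<m. c k * ((if bdd_above (J k) then \<phi> k (Sup (J k)) * w (\<gamma> k (Sup (J k))) else 0) -
     (if bdd_below (J k) then \<phi> k (Inf (J k)) * w (\<gamma> k (Inf (J k))) else 0))) =
     (\<Sum>k<m. if bdd_above (J k) then c k * \<phi> k (Sup (J k)) * w (\<gamma> k (Sup (J k))) else 0) -
     (\<Sum>k<m. if bdd_below (J k) then c k * \<phi> k (Inf (J k)) * w (\<gamma> k (Inf (J k))) else 0)"
    unfolding sum_subtractf[symmetric] by (intro sum.cong) (auto simp: right_diff_distrib mult.assoc)
  also have "\<dots> = (\<Sum>k\<in>?A. c k * \<phi> k (Sup (J k)) * w (\<gamma> k (Sup (J k)))) -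
      (\<Sum>k\<in>?B. c k * \<phi> k (Inf (J k)) * w (\<gamma> k (Inf (J k))))"
    by (simp only: sum.inter_filter[OF finite_lessThan])
  also have "\<dots> = (\<Sum>t\<in>T. w t * twisted_boundary m c J \<gamma> \<phi> t)"
    unfolding A B twisted_boundary_def sum_subtractf[symmetric] by (simp only: right_diff_distrib)
  also have "\<dots> = 0"
    by (simp add: assms)
  finally show ?thesis .
qed

text \<open>The total derivative is restricted to a complex line; complex linearity makes the
  restriction a multiplication by a complex number.\<close>

lemma has_partial_zI:
  assumes L: "(f has_derivative L) (at p)" and lin: "\<And>a v w. L (a *s v, a * w) = a * L (v, w)"
  shows "has_partial_z f i (L (axis i 1, 0)) p"
proof -
  have ax: "bounded_linear (axis i :: complex \<Rightarrow> complex ^ 'a)"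
    unfolding linear_conv_bounded_linear[symmetric]
    by (intro linearI) (auto simp: axis_def vec_eq_iff)
  have eq: "set_coord (fst p) i = (\<lambda>w. fst p + axis i (w - fst p $ i))"
    by (auto simp: set_coord_def axis_def vec_eq_iff fun_eq_iff)
  have "((\<lambda>w. (set_coord (fst p) i w, snd p)) has_derivative (\<lambda>h. (axis i h, 0))) (at (fst p $ i))"
    unfolding eq by (auto intro!: derivative_eq_intros bounded_linear.has_derivative[OF ax])
  moreover have "(set_coord (fst p) i (fst p $ i), snd p) = p"
    by (simp add: eq axis_def vec_eq_iff prod_eq_iff)
  then have "(f has_derivative L) (at (set_coord (fst p) i (fst p $ i), snd p))"
    using L by simp
  ultimately have "((\<lambda>w. f (set_coord (fst p) i w, snd p)) has_derivative (\<lambda>h. L (axis i h, 0))) (at (fst p $ i))"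
    by (rule has_derivative_compose)
  moreover have "L (axis i h, 0) = L (axis i 1, 0) * h" for h
  proof -
    have "(axis i h :: complex ^ 'a) = h *s axis i 1"
      by (auto simp: axis_def vec_eq_iff)
    then show ?thesis
      using lin[of h "axis i 1" 0] by (simp add: mult.commute)
  qed
  then have "(\<lambda>h. L (axis i h, 0)) = (*) (L (axis i 1, 0))"
    by (rule ext)
  ultimately show ?thesis
    by (simp only: has_partial_z_def has_field_derivative_def)
qed

lemma has_partial_lambdaI:
  assumes L: "(f has_derivative L) (at p)" and lin: "\<And>a v w. L (a *s v, a * w) = a * L (v, w)"
  shows "has_partial_lambda f (L (0, 1)) p"
proof -
  have "((\<lambda>w. (fst p, w)) has_derivative (\<lambda>h. (0, h))) (at (snd p))"
    by (auto intro!: derivative_eq_intros)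
  moreover have "(f has_derivative L) (at (fst p, snd p))"
    using L by simp
  ultimately have "((\<lambda>w. f (fst p, w)) has_derivative (\<lambda>h. L (0, h))) (at (snd p))"
    by (rule has_derivative_compose)
  moreover have "L (0, h) = L (0, 1) * h" for h
    using lin[of h 0 1] by (simp add: mult.commute)
  then have "(\<lambda>h. L (0, h)) = (*) (L (0, 1))"
    by (rule ext)
  ultimately show ?thesis
    by (simp only: has_partial_lambda_def has_field_derivative_def)
qed

section \<open>The system of differential equations\<close>

text \<open>\<open>boundary\<close> expresses that the twisted boundary vanishes at every parameter
  of \<open>U\<close>, tested against arbitrary weights, the shape in which \<open>Stokes\<close>
  delivers end point terms.\<close>

locale tame_cycle =
  fixes U :: "'n::finite params set" and m :: nat and c :: "nat \<Rightarrow> complex" and J :: "nat \<Rightarrow> real set"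
    and \<gamma> :: "nat \<Rightarrow> real \<Rightarrow> complex" and \<Psi> :: "'n params \<Rightarrow> nat \<Rightarrow> real \<Rightarrow> complex"
  assumes U: "open U" "convex U" "U \<subseteq> parameter_space"
    and tame: "\<And>k. k < m \<Longrightarrow> \<exists>P B \<eta> d. tame_path U (J k) (\<gamma> k) P B \<eta> d"
    and branch: "\<And>k p. k < m \<Longrightarrow> p \<in> U \<Longrightarrow> Phi_branch_along p (J k) (\<gamma> k) (\<Psi> p k)"
    and cont: "\<And>k p s. k < m \<Longrightarrow> p \<in> U \<Longrightarrow> s \<in> J k \<Longrightarrow> isCont (\<lambda>q. \<Psi> q k s) p"
    and boundary: "\<And>p w. p \<in> U \<Longrightarrow>
      (\<Sum>k<m. c k * ((if bdd_above (J k) then \<Psi> p k (Sup (J k)) * w (\<gamma> k (Sup (J k))) else 0) -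
        (if bdd_below (J k) then \<Psi> p k (Inf (J k)) * w (\<gamma> k (Inf (J k))) else 0))) = 0"
begin

text \<open>The integral of \<open>u\<close> \<Phi> dt over the cycle. The integrals
  \<open>I\<close> and their derivatives are moments of rational functions, so the system reduces to
  linear relations between moments.\<close>

definition moment :: "'n params \<Rightarrow> (complex \<Rightarrow> complex) \<Rightarrow> complex" where
  "moment p u = (\<Sum>k<m. c k *
     integral (J k) (\<lambda>s. u (\<gamma> k s) * \<Psi> p k s * vector_derivative (\<gamma> k) (at s)))"

text \<open>Carried along because \<open>integral\<close> is additive only on integrable
  functions.\<close>

definition has_moment :: "'n params \<Rightarrow> (complex \<Rightarrow> complex) \<Rightarrow> bool" where
  "has_moment p u \<longleftrightarrow> (\<forall>k<m.
     (\<lambda>s. u (\<gamma> k s) * \<Psi> p k s * vector_derivative (\<gamma> k) (at s)) integrable_on J k)"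

section \<open>Linearity of moments and moments of exact forms\<close>

lemma avoid: "p \<in> U \<Longrightarrow> k < m \<Longrightarrow> s \<in> J k \<Longrightarrow> \<gamma> k s \<noteq> fst p $ i"
  using tame tame_path.singular_point_avoided by metis

lemma bounded_on_paths:
  assumes "p \<in> U" "k < m"
  shows "\<exists>K\<ge>0. \<forall>s\<in>J k. \<forall>i. norm (1 / (\<gamma> k s - fst p $ i)) \<le> K"
proof -
  obtain P B \<eta> d where t: "tame_path U (J k) (\<gamma> k) P B \<eta> d"
    using tame assms by blast
  then interpret tame_path U "J k" "\<gamma> k" P B \<eta> d .
  show ?thesis
    using norm_inverse_le[OF assms(1)] pos(3) by (intro exI[of _ "1 / d"]) auto
qed

lemma has_moment_basic:
  assumes p: "p \<in> U"
  shows "has_moment p (\<lambda>t. 1)" "has_moment p (\<lambda>t. 1 / (t - fst p $ i))"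
    "has_moment p (\<lambda>t. 1 / (t - fst p $ i) * (1 / (t - fst p $ j)))"
proof -
  have "(\<lambda>s. 1 * \<Psi> p k s * vector_derivative (\<gamma> k) (at s)) integrable_on J k \<and>
    (\<lambda>s. 1 / (\<gamma> k s - fst p $ i) * \<Psi> p k s * vector_derivative (\<gamma> k) (at s)) integrable_on J k \<and>
    (\<lambda>s. 1 / (\<gamma> k s - fst p $ i) * (1 / (\<gamma> k s - fst p $ j)) * \<Psi> p k s * vector_derivative (\<gamma> k) (at s))
      integrable_on J k" if k: "k < m" for k
  proof -
    obtain P B \<eta> d where t: "tame_path U (J k) (\<gamma> k) P B \<eta> d"
      using tame k by blast
    then interpret tame_path U "J k" "\<gamma> k" P B \<eta> d .
    obtain K where K: "\<And>s i. s \<in> J k \<Longrightarrow> norm (1 / (\<gamma> k s - fst p $ i)) \<le> K" "0 \<le> K"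
      using bounded_on_paths[OF p k] by blast
    note int = bounded_moment_integrable[OF p branch[OF k p]]
    show ?thesis
    proof (intro conjI)
      show "(\<lambda>s. 1 * \<Psi> p k s * vector_derivative (\<gamma> k) (at s)) integrable_on J k"
        by (rule int[where K = 1]) auto
      show "(\<lambda>s. 1 / (\<gamma> k s - fst p $ i) * \<Psi> p k s * vector_derivative (\<gamma> k) (at s)) integrable_on J k"
        by (rule int[OF continuous_on_inverse_diff[OF p] K(1)])
      show "(\<lambda>s. 1 / (\<gamma> k s - fst p $ i) * (1 / (\<gamma> k s - fst p $ j)) * \<Psi> p k s * vector_derivative (\<gamma> k) (at s))
          integrable_on J k"
      proof (rule int[where K = "K * K"])
        show "continuous_on (J k) (\<lambda>s. 1 / (\<gamma> k s - fst p $ i) * (1 / (\<gamma> k s - fst p $ j)))"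
          by (intro continuous_on_mult continuous_on_inverse_diff p)
        show "norm (1 / (\<gamma> k s - fst p $ i) * (1 / (\<gamma> k s - fst p $ j))) \<le> K * K" if "s \<in> J k" for s
          using K(1)[OF that] K(2) unfolding norm_mult by (intro mult_mono) auto
      qed
    qed
  qed
  then show "has_moment p (\<lambda>t. 1)" "has_moment p (\<lambda>t. 1 / (t - fst p $ i))"
    "has_moment p (\<lambda>t. 1 / (t - fst p $ i) * (1 / (t - fst p $ j)))"
    unfolding has_moment_def by blast+
qed

text \<open>Identities between rational functions may fail at the poles, where division by zero
  gives 0; the paths avoid these points.\<close>

lemma moment_cong:
  assumes "p \<in> U" "\<And>t. (\<And>i. t \<noteq> fst p $ i) \<Longrightarrow> u t = v t"
  shows "moment p u = moment p v"
  unfolding moment_def using avoid[OF assms(1)] assms(2)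
  by (intro sum.cong arg_cong2[where f = "(*)"] Henstock_Kurzweil_Integration.integral_cong) auto

lemma moment_cmult: "moment p (\<lambda>t. a * u t) = a * moment p u"
proof -
  have "integral (J k) (\<lambda>s. a * u (\<gamma> k s) * \<Psi> p k s * vector_derivative (\<gamma> k) (at s)) =
      a * integral (J k) (\<lambda>s. u (\<gamma> k s) * \<Psi> p k s * vector_derivative (\<gamma> k) (at s))" for k
    by (simp add: mult.assoc)
  then show ?thesis
    unfolding moment_def sum_distrib_left by (intro sum.cong refl) (simp only: mult.left_commute)
qed

lemma has_moment_cmult: "has_moment p u \<Longrightarrow> has_moment p (\<lambda>t. a * u t)"
  unfolding has_moment_def mult.assoc by (intro allI impI integrable_on_mult_right) simp

lemma moment_add:
  assumes "has_moment p u" "has_moment p v"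
  shows "moment p (\<lambda>t. u t + v t) = moment p u + moment p v" "has_moment p (\<lambda>t. u t + v t)"
  using assms unfolding moment_def has_moment_def
  by (auto simp: distrib_right Henstock_Kurzweil_Integration.integral_add distrib_left
      integrable_add simp flip: sum.distrib)

lemma moment_diff:
  assumes "has_moment p u" "has_moment p v"
  shows "moment p (\<lambda>t. u t - v t) = moment p u - moment p v" "has_moment p (\<lambda>t. u t - v t)"
  using moment_add[OF assms(1) has_moment_cmult[OF assms(2), of "-1"]] moment_cmult[of p "-1" v] by simp_all

lemma moment_sum:
  assumes "finite A" "\<And>j. j \<in> A \<Longrightarrow> has_moment p (u j)"
  shows "moment p (\<lambda>t. \<Sum>j\<in>A. u j t) = (\<Sum>j\<in>A. moment p (u j)) \<and> has_moment p (\<lambda>t. \<Sum>j\<in>A. u j t)"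
  using assms
proof (induction A rule: finite_induct)
  case empty
  then show ?case
    by (simp add: moment_def has_moment_def integrable_0)
next
  case (insert x A)
  then show ?case
    using moment_add[of p "u x" "\<lambda>t. \<Sum>j\<in>A. u j t"] by simp
qed

text \<open>\<open>Stokes\<close> on each path leaves only end point terms, and these cancel by
  \<open>boundary\<close> with weight \<open>h\<close>.\<close>

lemma moment_exact:
  assumes p: "p \<in> U"
    and der: "\<And>t. (\<And>i. t \<noteq> fst p $ i) \<Longrightarrow> (h has_field_derivative h' t) (at t)"
    and bound: "\<And>k. k < m \<Longrightarrow> \<exists>K. \<forall>s\<in>J k. norm (h (\<gamma> k s)) \<le> K \<and> norm (h' (\<gamma> k s)) \<le> K"
  shows "moment p (\<lambda>t. (snd p - 1 / 2 * (\<Sum>j\<in>UNIV. 1 / (t - fst p $ j))) * h t + h' t) = 0"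
proof -
  have "integral (J k) (\<lambda>s. ((snd p - 1 / 2 * (\<Sum>j\<in>UNIV. 1 / (\<gamma> k s - fst p $ j))) * h (\<gamma> k s) + h' (\<gamma> k s))
       * \<Psi> p k s * vector_derivative (\<gamma> k) (at s)) =
     (if bdd_above (J k) then \<Psi> p k (Sup (J k)) * h (\<gamma> k (Sup (J k))) else 0) -
     (if bdd_below (J k) then \<Psi> p k (Inf (J k)) * h (\<gamma> k (Inf (J k))) else 0)" if k: "k < m" for k
  proof -
    obtain P B \<eta> d where t: "tame_path U (J k) (\<gamma> k) P B \<eta> d"
      using tame k by blast
    then interpret tame_path U "J k" "\<gamma> k" P B \<eta> d .
    obtain K where "\<forall>s\<in>J k. norm (h (\<gamma> k s)) \<le> K \<and> norm (h' (\<gamma> k s)) \<le> K"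
      using bound[OF k] by blast
    then show ?thesis
      using avoid[OF p k] by (intro integral_unique Stokes[OF p branch[OF k p], where K = K] der) auto
  qed
  then show ?thesis
    using boundary[OF p, of h] by (simp add: moment_def)
qed

section \<open>Derivatives of the integrals as moments\<close>

abbreviation "I i p \<equiv> twisted_integral m c J \<gamma> \<Psi> i p"

lemma I_eq_moment: "I i p = moment p (\<lambda>t. 1 / (t - fst p $ i))"
  by (simp add: twisted_integral_def moment_def pulled_back_form_def[abs_def])

lemma pulled_back_form_integrable:
  "p \<in> U \<Longrightarrow> k < m \<Longrightarrow> pulled_back_form p (\<gamma> k) (\<Psi> p k) i integrable_on J k"
  using has_moment_basic(2)[of p i] by (simp add: has_moment_def pulled_back_form_def[abs_def])

text \<open>The coefficient of \<Phi> dt in the derivative of \<Phi> dt / (t - z_i) in the parameter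
  direction \<open>h\<close>.\<close>

definition log_form :: "'n params \<Rightarrow> 'n \<Rightarrow> 'n params \<Rightarrow> complex \<Rightarrow> complex" where
  "log_form p i h t = (snd h * t + 1 / 2 * (\<Sum>j\<in>UNIV. fst h $ j / (t - fst p $ j))
     + fst h $ i / (t - fst p $ i)) / (t - fst p $ i)"

lemma I_has_derivative:
  assumes p: "p \<in> U"
  shows "(I i has_derivative (\<lambda>h. moment p (log_form p i h))) (at p)"
  unfolding moment_def twisted_integral_def log_form_def
proof (intro has_derivative_sum has_derivative_mult_right)
  fix k assume "k \<in> {..<m}"
  then have k: "k < m" by simp
  obtain P B \<eta> d where t: "tame_path U (J k) (\<gamma> k) P B \<eta> d"
    using tame k by blast
  then interpret tame_path U "J k" "\<gamma> k" P B \<eta> d .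
  show "((\<lambda>p. integral (J k) (pulled_back_form p (\<gamma> k) (\<Psi> p k) i)) has_derivative
    (\<lambda>h. integral (J k) (\<lambda>s. (snd h * \<gamma> k s + 1 / 2 * (\<Sum>j\<in>UNIV. fst h $ j / (\<gamma> k s - fst p $ j))
         + fst h $ i / (\<gamma> k s - fst p $ i)) / (\<gamma> k s - fst p $ i) * \<Psi> p k s
         * vector_derivative (\<gamma> k) (at s)))) (at p)"
    using branch[OF k] tame_cycle.cont[OF tame_cycle_axioms k] by (intro Leibniz[OF U(1,2) p])
qed

lemma log_form_linear: "moment p (log_form p i (a *s v, a * w)) = a * moment p (log_form p i (v, w))"
proof -
  have "log_form p i (a *s v, a * w) = (\<lambda>t. a * log_form p i (v, w) t)"
    by (rule ext) (simp add: log_form_def sum_distrib_left algebra_simps add_divide_distrib)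
  then show ?thesis
    using moment_cmult[of p a "log_form p i (v, w)"] by simp
qed

lemma I_jointly_holomorphic: "jointly_holomorphic_on (I i) U"
  unfolding jointly_holomorphic_on_def using I_has_derivative log_form_linear by blast

lemmas I_partial_z = has_partial_zI[OF I_has_derivative log_form_linear]
lemmas I_partial_lambda = has_partial_lambdaI[OF I_has_derivative log_form_linear]

text \<open>Off the diagonal these reduce to the integrals \<open>I\<close> by partial fractions;
  the double pole \<open>II p i i\<close> is eliminated by an exact form.\<close>

definition II :: "'n params \<Rightarrow> 'n \<Rightarrow> 'n \<Rightarrow> complex" where
  "II p i j = moment p (\<lambda>t. 1 / (t - fst p $ i) * (1 / (t - fst p $ j)))"

section \<open>Relations between the integrals and the equations of the system\<close>

lemma distinct_points: "p \<in> U \<Longrightarrow> i \<noteq> j \<Longrightarrow> fst p $ i \<noteq> fst p $ j"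
  using U(3) by (auto simp: parameter_space_def)

lemma partial_fractions:
  assumes p: "p \<in> U" and "i \<noteq> j"
  shows "II p i j = (I i p - I j p) / (fst p $ i - fst p $ j)"
proof -
  have "II p i j = moment p (\<lambda>t. 1 / (fst p $ i - fst p $ j) * (1 / (t - fst p $ i) - 1 / (t - fst p $ j)))"
    unfolding II_def using distinct_points[OF assms]
    by (intro moment_cong[OF p]) (simp add: field_simps)
  then show ?thesis
    by (simp only: moment_cmult moment_diff has_moment_basic[OF p] I_eq_moment) simp
qed

lemma sum_axis: "(\<Sum>j\<in>UNIV. axis i (1::complex) $ j / f j) = 1 / f i"
  by (subst sum.remove[of UNIV i]) (auto simp: axis_def intro!: sum.neutral)

lemma log_form_axis:
  "log_form p i (axis j 1, 0) t =
     (1 / 2 * (1 / (t - fst p $ j)) + axis j 1 $ i / (t - fst p $ i)) / (t - fst p $ i)"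
  by (simp only: log_form_def fst_conv snd_conv sum_axis mult_zero_left add_0)

lemma partial_z_off_diagonal:
  assumes p: "p \<in> U" and "i \<noteq> j"
  shows "has_partial_z (I j) i (1 / 2 * ((I i p - I j p) / (fst p $ i - fst p $ j))) p"
proof -
  have "log_form p j (axis i 1, 0) = (\<lambda>t. 1 / 2 * (1 / (t - fst p $ i) * (1 / (t - fst p $ j))))"
    using assms(2) by (intro ext) (simp only: log_form_axis, simp add: axis_def)
  then have "moment p (log_form p j (axis i 1, 0)) = 1 / 2 * II p i j"
    by (simp only: moment_cmult II_def)
  then show ?thesis
    using I_partial_z[OF p, of j i] partial_fractions[OF assms] by simp
qed

text \<open>The vanishing integral of d\<Phi>, that is, \<open>moment_exact\<close> with
  \<open>h = 1\<close>.\<close>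

lemma exact_form_1:
  assumes p: "p \<in> U"
  shows "snd p * moment p (\<lambda>t. 1) = 1 / 2 * (\<Sum>j\<in>UNIV. I j p)"
proof -
  have "moment p (\<lambda>t. (snd p - 1 / 2 * (\<Sum>j\<in>UNIV. 1 / (t - fst p $ j))) * 1 + 0) = 0"
    by (rule moment_exact[OF p]) (auto intro!: exI[of _ 1])
  then have "moment p (\<lambda>t. snd p * 1 - 1 / 2 * (\<Sum>j\<in>UNIV. 1 / (t - fst p $ j))) = 0"
    by simp
  moreover have s: "moment p (\<lambda>t. \<Sum>j\<in>UNIV. 1 / (t - fst p $ j)) = (\<Sum>j\<in>UNIV. I j p)"
    "has_moment p (\<lambda>t. \<Sum>j\<in>UNIV. 1 / (t - fst p $ j))"
    using moment_sum[of UNIV p "\<lambda>j t. 1 / (t - fst p $ j)"] has_moment_basic[OF p]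
    by (auto simp: I_eq_moment)
  moreover have "moment p (\<lambda>t. snd p * 1 - 1 / 2 * (\<Sum>j\<in>UNIV. 1 / (t - fst p $ j))) =
      snd p * moment p (\<lambda>t. 1) - 1 / 2 * moment p (\<lambda>t. \<Sum>j\<in>UNIV. 1 / (t - fst p $ j))"
    by (simp only: moment_diff(1) has_moment_cmult has_moment_basic[OF p] s(2) moment_cmult)
  ultimately show ?thesis
    by simp
qed

text \<open>The vanishing integral of d(\<Phi> / (t - z_i)); the last term is the derivative of
  \<open>1 / (t - z_i)\<close>.\<close>

lemma exact_form_2:
  assumes p: "p \<in> U"
  shows "snd p * I i p - 1 / 2 * (\<Sum>j\<in>UNIV. II p i j) - II p i i = 0"
proof -
  let ?z = "fst p"
  have "moment p (\<lambda>t. (snd p - 1 / 2 * (\<Sum>j\<in>UNIV. 1 / (t - ?z $ j))) * (1 / (t - ?z $ i))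
      + - (1 / (t - ?z $ i) * (1 / (t - ?z $ i)))) = 0"
  proof (rule moment_exact[OF p])
    show "((\<lambda>t. 1 / (t - ?z $ i)) has_field_derivative - (1 / (t - ?z $ i) * (1 / (t - ?z $ i)))) (at t)"
      if "\<And>i. t \<noteq> ?z $ i" for t
      using that[of i] by (auto intro!: derivative_eq_intros)
    fix k assume k: "k < m"
    obtain K where K: "\<And>s i. s \<in> J k \<Longrightarrow> norm (1 / (\<gamma> k s - ?z $ i)) \<le> K" "0 \<le> K"
      using bounded_on_paths[OF p k] by blast
    have "norm (1 / (\<gamma> k s - ?z $ i) * (1 / (\<gamma> k s - ?z $ i))) \<le> K * K" if "s \<in> J k" for s
      using K(1)[OF that] K(2) unfolding norm_mult by (intro mult_mono) auto
    then show "\<exists>K. \<forall>s\<in>J k. norm (1 / (\<gamma> k s - ?z $ i)) \<le> K \<and>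
        norm (- (1 / (\<gamma> k s - ?z $ i) * (1 / (\<gamma> k s - ?z $ i)))) \<le> K"
      using K(1) by (intro exI[of _ "max K (K * K)"]) (simp only: norm_minus_cancel le_max_iff_disj, blast)
  qed
  \<comment> \<open>Proved for abstract letters and then used as a rewrite rule, so that the
    products of reciprocals keep the shape they have in \<open>II\<close>.\<close>
  moreover have "(a - b * S) * x + - y = a * x - b * (x * S) - y" for a b S x y :: complex
    by (simp add: algebra_simps)
  then have "(\<lambda>t. (snd p - 1 / 2 * (\<Sum>j\<in>UNIV. 1 / (t - ?z $ j))) * (1 / (t - ?z $ i))
      + - (1 / (t - ?z $ i) * (1 / (t - ?z $ i)))) =
     (\<lambda>t. snd p * (1 / (t - ?z $ i)) - 1 / 2 * (\<Sum>j\<in>UNIV. 1 / (t - ?z $ i) * (1 / (t - ?z $ j)))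
      - 1 / (t - ?z $ i) * (1 / (t - ?z $ i)))"
    by (simp only:) (simp only: sum_distrib_left)
  ultimately have "moment p (\<lambda>t. snd p * (1 / (t - ?z $ i)) - 1 / 2 * (\<Sum>j\<in>UNIV. 1 / (t - ?z $ i) * (1 / (t - ?z $ j)))
      - 1 / (t - ?z $ i) * (1 / (t - ?z $ i))) = 0"
    by (simp only:)
  moreover have s: "moment p (\<lambda>t. \<Sum>j\<in>UNIV. 1 / (t - ?z $ i) * (1 / (t - ?z $ j))) = (\<Sum>j\<in>UNIV. II p i j)"
    "has_moment p (\<lambda>t. \<Sum>j\<in>UNIV. 1 / (t - ?z $ i) * (1 / (t - ?z $ j)))"
    using moment_sum[of UNIV p "\<lambda>j t. 1 / (t - ?z $ i) * (1 / (t - ?z $ j))", OF finite has_moment_basic(3)[OF p]]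
    unfolding II_def by blast+
  moreover have "moment p (\<lambda>t. snd p * (1 / (t - ?z $ i)) - 1 / 2 * (\<Sum>j\<in>UNIV. 1 / (t - ?z $ i) * (1 / (t - ?z $ j)))
      - 1 / (t - ?z $ i) * (1 / (t - ?z $ i))) =
    snd p * moment p (\<lambda>t. 1 / (t - ?z $ i)) - 1 / 2 * moment p (\<lambda>t. \<Sum>j\<in>UNIV. 1 / (t - ?z $ i) * (1 / (t - ?z $ j)))
      - moment p (\<lambda>t. 1 / (t - ?z $ i) * (1 / (t - ?z $ i)))"
    by (simp only: moment_diff has_moment_cmult has_moment_basic[OF p] s(2) moment_cmult)
  ultimately show ?thesis
    by (simp only: I_eq_moment II_def)
qed

text \<open>The double pole occurs with coefficient 1/2 from \<Phi> plus 1 from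
  \<open>1 / (t - z_i)\<close>. In \<open>exact_form_2\<close> it also occurs with total weight 3/2,
  once by itself and once halved inside the sum, so it is eliminated completely.\<close>

lemma partial_z_diagonal:
  assumes p: "p \<in> U"
  shows "has_partial_z (I i) i
     (snd p * I i p - 1 / 2 * (\<Sum>j\<in>UNIV - {i}. (I i p - I j p) / (fst p $ i - fst p $ j))) p"
proof -
  have "log_form p i (axis i 1, 0) = (\<lambda>t. 3 / 2 * (1 / (t - fst p $ i) * (1 / (t - fst p $ i))))"
  proof
    fix t
    have "(1 / 2 * (1 / a) + 1 / a) / a = 3 / 2 * (1 / a * (1 / a))" for a :: complex
      by (cases "a = 0") (auto simp: field_simps)
    then show "log_form p i (axis i 1, 0) t = 3 / 2 * (1 / (t - fst p $ i) * (1 / (t - fst p $ i)))"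
      by (simp only: log_form_axis axis_nth)
  qed
  then have "moment p (log_form p i (axis i 1, 0)) = 3 / 2 * II p i i"
    by (simp only: moment_cmult II_def)
  moreover have "(\<Sum>j\<in>UNIV. II p i j) = II p i i + (\<Sum>j\<in>UNIV - {i}. (I i p - I j p) / (fst p $ i - fst p $ j))"
    by (subst sum.remove[of UNIV i]) (auto intro!: sum.cong partial_fractions[OF p])
  ultimately have "moment p (log_form p i (axis i 1, 0)) =
      snd p * I i p - 1 / 2 * (\<Sum>j\<in>UNIV - {i}. (I i p - I j p) / (fst p $ i - fst p $ j))"
    using exact_form_2[OF p, of i] by (simp add: field_simps)
  then show ?thesis
    using I_partial_z[OF p, of i i] by simp
qed

text \<open>Differentiation in \<lambda> multiplies the integrand by \<open>t\<close>, and
  \<open>t / (t - z_i) = z_i / (t - z_i) + 1\<close>; the constant term is evaluated by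
  \<open>exact_form_1\<close>.\<close>

lemma partial_lambda:
  assumes p: "p \<in> U"
  shows "has_partial_lambda (I i) (fst p $ i * I i p + 1 / (2 * snd p) * (\<Sum>j\<in>UNIV. I j p)) p"
proof -
  have "snd p \<noteq> 0"
    using U(3) p by (auto simp: parameter_space_def)
  then have "moment p (\<lambda>t. 1) = 1 / (2 * snd p) * (\<Sum>j\<in>UNIV. I j p)"
    using exact_form_1[OF p] by (simp add: field_simps)
  moreover have "moment p (log_form p i (0, 1)) = moment p (\<lambda>t. fst p $ i * (1 / (t - fst p $ i)) + 1)"
    by (rule moment_cong[OF p]) (simp add: log_form_def field_simps)
  moreover have "\<dots> = fst p $ i * I i p + moment p (\<lambda>t. 1)"
    by (simp only: moment_add has_moment_cmult has_moment_basic[OF p] moment_cmult I_eq_moment)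
  ultimately show ?thesis
    using I_partial_lambda[OF p, of i] by simp
qed

end

section \<open>Choice of the neighbourhood and conclusion\<close>

lemma open_parameter_space: "open (parameter_space :: 'n::finite params set)"
proof -
  have "(parameter_space :: 'n params set) =
      (\<Inter>i. \<Inter>j\<in>UNIV - {i}. {p. fst p $ i \<noteq> fst p $ j}) \<inter> {p. snd p \<noteq> 0}"
    by (auto simp: parameter_space_def)
  also have "open \<dots>"
    by (intro open_Int open_INT ballI open_Collect_neq continuous_intros) auto
  finally show ?thesis .
qed

lemma jointly_holomorphic_on_continuous_on:
  "jointly_holomorphic_on f U \<Longrightarrow> continuous_on U f"
  by (simp add: continuous_at_imp_continuous_on jointly_holomorphic_on_isCont)

text \<open>Stated for all sufficiently small radii, so that finitely many paths can share
  one.\<close>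

lemma tame_radius:
  fixes p0 :: "'n::finite params"
  assumes "admissible_path p0 J \<gamma>"
  shows "\<forall>\<^sub>F r in at_right 0. (\<exists>P B \<eta> d. tame_path (ball p0 r) J \<gamma> P B \<eta> d) \<and>
     (\<forall>p\<in>ball p0 r. \<forall>s\<in>J. \<forall>i. norm (fst p $ i - fst p0 $ i) < norm (\<gamma> s - fst p0 $ i))"
proof -
  obtain R P B \<eta> d where R: "0 < R" and t: "tame_path (ball p0 R) J \<gamma> P B \<eta> d"
    using admissible_path_tame[OF assms] by blast
  interpret tame_path "ball p0 R" J \<gamma> P B \<eta> d by (rule t)
  show ?thesis
    unfolding eventually_at_right_field
  proof (intro exI[of _ "min R d"] conjI allI impI ballI)
    fix r assume r: "0 < r" "r < min R d"
    show "\<exists>P B \<eta> d. tame_path (ball p0 r) J \<gamma> P B \<eta> d"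
      using tame_path_mono[OF t, of "ball p0 r"] r by (metis less_imp_le min_less_iff_conj subset_ball)
    fix p s i assume p: "p \<in> ball p0 r" and s: "s \<in> J"
    have "norm (fst p $ i - fst p0 $ i) \<le> norm (fst p - fst p0)"
      using Finite_Cartesian_Product.norm_nth_le[of "fst p - fst p0" i] by simp
    also have "\<dots> < d"
      using fst_snd_ball(1)[OF p] r by (simp add: dist_norm norm_minus_commute)
    also have "d \<le> norm (\<gamma> s - fst p0 $ i)"
      using R s by (intro sep) auto
    finally show "norm (fst p $ i - fst p0 $ i) < norm (\<gamma> s - fst p0 $ i)" .
  qed (use R pos in auto)
qed

theorem theorem1p1:
  fixes g m :: nat
    and z0 :: "complex ^ 'n::finite"
    and l0 :: complex
    and c :: "nat \<Rightarrow> complex"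
    and J :: "nat \<Rightarrow> real set"
    and \<gamma> \<phi> :: "nat \<Rightarrow> real \<Rightarrow> complex"
  assumes "g > 0"
    and "CARD('n) = 2 * g + 1"
    and "(z0, l0) \<in> parameter_space"
    and "twisted_cycle (z0, l0) m c J \<gamma> \<phi>"
  shows "\<exists>U. open U \<and> connected U \<and> (z0, l0) \<in> U \<and> U \<subseteq> parameter_space \<and>
    (\<exists>\<Psi>. branch_continuation U (z0, l0) m J \<gamma> \<phi> \<Psi>) \<and>
    (\<forall>\<Psi>. branch_continuation U (z0, l0) m J \<gamma> \<phi> \<Psi> \<longrightarrow>
      (\<forall>p\<in>U. \<forall>k<m. \<forall>i. pulled_back_form p (\<gamma> k) (\<Psi> p k) i integrable_on J k) \<and>
      (let I = twisted_integral m c J \<gamma> \<Psi> in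
        (\<forall>i. jointly_holomorphic_on (I i) U) \<and>
        (\<forall>z l. (z, l) \<in> U \<longrightarrow>
          (\<forall>i j. i \<noteq> j \<longrightarrow>
            has_partial_z (I j) i
              (1 / 2 * ((I i (z, l) - I j (z, l)) / (z $ i - z $ j))) (z, l)) \<and>
          (\<forall>i. has_partial_z (I i) i
              (l * I i (z, l)
                - 1 / 2 * (\<Sum>j\<in>UNIV - {i}. (I i (z, l) - I j (z, l)) / (z $ i - z $ j))) (z, l)) \<and>
          (\<forall>i. has_partial_lambda (I i)
              (z $ i * I i (z, l) + 1 / (2 * l) * (\<Sum>j\<in>UNIV. I j (z, l))) (z, l)))))"
proof -
  let ?p0 = "(z0, l0)"
  have adm: "admissible_path ?p0 (J k) (\<gamma> k)" and br0: "Phi_branch_along ?p0 (J k) (\<gamma> k) (\<phi> k)"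
    if "k < m" for k
    using assms(4) that by (auto simp: twisted_cycle_def)
  have bdry: "twisted_boundary m c J \<gamma> \<phi> t = 0" for t
    using assms(4) by (auto simp: twisted_cycle_def)
  obtain R where R: "0 < R" "ball ?p0 R \<subseteq> parameter_space"
    using openE[OF open_parameter_space assms(3)] by blast
  have "\<forall>\<^sub>F r in at_right 0. 0 < r \<and> r < R"
    using R(1) by (auto simp: eventually_at_right_field)
  moreover have "\<forall>\<^sub>F r in at_right 0. \<forall>k\<in>{..<m}.
     (\<exists>P B \<eta> d. tame_path (ball ?p0 r) (J k) (\<gamma> k) P B \<eta> d) \<and>
     (\<forall>p\<in>ball ?p0 r. \<forall>s\<in>J k. \<forall>i. norm (fst p $ i - fst ?p0 $ i) < norm (\<gamma> k s - fst ?p0 $ i))"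
    by (intro eventually_ball_finite ballI tame_radius adm) auto
  ultimately have "\<forall>\<^sub>F r in at_right 0. (0 < r \<and> r < R) \<and> (\<forall>k\<in>{..<m}.
     (\<exists>P B \<eta> d. tame_path (ball ?p0 r) (J k) (\<gamma> k) P B \<eta> d) \<and>
     (\<forall>p\<in>ball ?p0 r. \<forall>s\<in>J k. \<forall>i. norm (fst p $ i - fst ?p0 $ i) < norm (\<gamma> k s - fst ?p0 $ i)))"
    by (rule eventually_conj)
  then obtain r where r: "0 < r" "r < R"
    and tame: "\<And>k. k < m \<Longrightarrow> \<exists>P B \<eta> d. tame_path (ball ?p0 r) (J k) (\<gamma> k) P B \<eta> d"
    and near: "\<And>k p s i. k < m \<Longrightarrow> p \<in> ball ?p0 r \<Longrightarrow> s \<in> J k \<Longrightarrow>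
      norm (fst p $ i - fst ?p0 $ i) < norm (\<gamma> k s - fst ?p0 $ i)"
    using eventually_happens[of _ "at_right (0::real)"] by (force simp del: fst_conv)
  define U where "U = ball ?p0 r"
  have U: "open U" "convex U" "connected U" "?p0 \<in> U" "U \<subseteq> parameter_space"
    using r R(2) subset_ball[of r R ?p0] by (auto simp: U_def convex_connected)
  \<comment> \<open>This explicit continuation proves existence and is also the one with which every
    other continuation is compared.\<close>
  define \<Psi>0 where "\<Psi>0 = (\<lambda>p k s. \<phi> k s * branch_factor ?p0 p (\<gamma> k s))"
  have \<Psi>0_val: "\<Psi>0 p k s \<in> Phi_values p (\<gamma> k s)" if "k < m" "p \<in> U" "s \<in> J k" for p k s
    unfolding \<Psi>0_def using br0[OF that(1)] near that
    by (intro branch_factor_Phi_values) (auto simp: Phi_branch_along_def U_def simp del: mem_ball)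
  have \<Psi>0_cont: "isCont (\<lambda>p. \<Psi>0 p k s) p" if "k < m" "p \<in> U" "s \<in> J k" for p k s
    unfolding \<Psi>0_def using near that
    by (intro isCont_mult continuous_const isCont_branch_factor_params) (auto simp: U_def simp del: mem_ball)
  have "branch_continuation U ?p0 m J \<gamma> \<phi> \<Psi>0"
    unfolding branch_continuation_def
  proof (intro allI impI conjI ballI)
    fix k assume k: "k < m"
    show "\<Psi>0 ?p0 k s = \<phi> k s" for s
      by (simp add: \<Psi>0_def)
    show "jointly_holomorphic_on (\<lambda>p. \<Psi>0 p k s) U" if "s \<in> J k" for s
      by (rule branch_jointly_holomorphic[OF U(1) \<Psi>0_val[OF k _ that] \<Psi>0_cont[OF k _ that]])
    show "Phi_branch_along p (J k) (\<gamma> k) (\<Psi>0 p k)" if p: "p \<in> U" for p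
    proof -
      have "continuous_on (J k) (\<gamma> k)"
        using adm[OF k] by (simp add: admissible_path_def piecewise_smooth_on_def)
      then have "continuous_on (J k) (\<lambda>s. branch_factor ?p0 p (\<gamma> k s))"
        using near[OF k] p by (intro continuous_on_branch_factor_path) (auto simp: U_def simp del: mem_ball)
      then have "continuous_on (J k) (\<Psi>0 p k)"
        unfolding \<Psi>0_def using br0[OF k] by (intro continuous_on_mult) (auto simp: Phi_branch_along_def)
      then show ?thesis
        using \<Psi>0_val[OF k p] by (simp add: Phi_branch_along_def)
    qed
  qed
  moreover have "(\<forall>p\<in>U. \<forall>k<m. \<forall>i. pulled_back_form p (\<gamma> k) (\<Psi> p k) i integrable_on J k) \<and>
      (let I = twisted_integral m c J \<gamma> \<Psi> in
        (\<forall>i. jointly_holomorphic_on (I i) U) \<and>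
        (\<forall>z l. (z, l) \<in> U \<longrightarrow>
          (\<forall>i j. i \<noteq> j \<longrightarrow>
            has_partial_z (I j) i
              (1 / 2 * ((I i (z, l) - I j (z, l)) / (z $ i - z $ j))) (z, l)) \<and>
          (\<forall>i. has_partial_z (I i) i
              (l * I i (z, l)
                - 1 / 2 * (\<Sum>j\<in>UNIV - {i}. (I i (z, l) - I j (z, l)) / (z $ i - z $ j))) (z, l)) \<and>
          (\<forall>i. has_partial_lambda (I i)
              (z $ i * I i (z, l) + 1 / (2 * l) * (\<Sum>j\<in>UNIV. I j (z, l))) (z, l))))"
    if "branch_continuation U ?p0 m J \<gamma> \<phi> \<Psi>" for \<Psi>
  proof -
    have init: "\<Psi> ?p0 k s = \<phi> k s" and hol: "jointly_holomorphic_on (\<lambda>p. \<Psi> p k s) U"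
      if "k < m" "s \<in> J k" for k s
      using \<open>branch_continuation U ?p0 m J \<gamma> \<phi> \<Psi>\<close> that by (auto simp: branch_continuation_def)
    have br: "Phi_branch_along p (J k) (\<gamma> k) (\<Psi> p k)" if "k < m" "p \<in> U" for k p
      using \<open>branch_continuation U ?p0 m J \<gamma> \<phi> \<Psi>\<close> that by (auto simp: branch_continuation_def)
    \<comment> \<open>By uniqueness over the connected ball, an arbitrary continuation differs from
      the given branches by a factor that depends only on the position
      \<open>\<gamma> k s\<close>.\<close>
    have eq: "\<Psi> p k s = \<phi> k s * branch_factor ?p0 p (\<gamma> k s)" if "k < m" "p \<in> U" "s \<in> J k" for p k s
    proof -
      have "\<Psi> p k s = \<Psi>0 p k s"
      proof (rule branch_continuation_unique[OF U(3,4)])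
        show "continuous_on U (\<lambda>p. \<Psi> p k s)"
          using hol[OF that(1,3)] by (rule jointly_holomorphic_on_continuous_on)
        show "\<Psi> q k s \<in> Phi_values q (\<gamma> k s)" if "q \<in> U" for q
          using br[OF \<open>k < m\<close> that] \<open>s \<in> J k\<close> by (simp add: Phi_branch_along_def)
        show "continuous_on U (\<lambda>p. \<Psi>0 p k s)"
          using \<Psi>0_cont that by (intro continuous_at_imp_continuous_on) auto
        show "\<Psi> ?p0 k s = \<Psi>0 ?p0 k s"
          using init that by (simp add: \<Psi>0_def)
      qed (use \<Psi>0_val that in auto)
      then show ?thesis
        by (simp add: \<Psi>0_def)
    qed
    interpret tame_cycle U m c J \<gamma> \<Psi>
    proof
      show "open U" "convex U" "U \<subseteq> parameter_space"
        by (fact U)+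
      show "\<exists>P B \<eta> d. tame_path U (J k) (\<gamma> k) P B \<eta> d" if "k < m" for k
        unfolding U_def using that by (rule tame)
      show "Phi_branch_along p (J k) (\<gamma> k) (\<Psi> p k)" if "k < m" "p \<in> U" for k p
        using that by (rule br)
      show "isCont (\<lambda>q. \<Psi> q k s) p" if "k < m" "p \<in> U" "s \<in> J k" for k p s
        using hol[OF that(1,3)] that(2) by (rule jointly_holomorphic_on_isCont)
      fix p w assume p: "p \<in> U"
      have ends: "Sup (J k) \<in> J k" if "bdd_above (J k)" "k < m" for k
        using adm[OF that(2)] that(1) by (auto simp: admissible_path_def intro: closed_contains_Sup)
      have ends': "Inf (J k) \<in> J k" if "bdd_below (J k)" "k < m" for k
        using adm[OF that(2)] that(1) by (auto simp: admissible_path_def intro: closed_contains_Inf)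
      have above: "(if bdd_above (J k) then \<Psi> p k (Sup (J k)) * w (\<gamma> k (Sup (J k))) else 0) =
          (if bdd_above (J k) then \<phi> k (Sup (J k)) *
            (branch_factor ?p0 p (\<gamma> k (Sup (J k))) * w (\<gamma> k (Sup (J k)))) else 0)" if "k < m" for k
        using eq[OF that p ends[OF _ that]] by (simp add: mult.assoc)
      have below: "(if bdd_below (J k) then \<Psi> p k (Inf (J k)) * w (\<gamma> k (Inf (J k))) else 0) =
          (if bdd_below (J k) then \<phi> k (Inf (J k)) *
            (branch_factor ?p0 p (\<gamma> k (Inf (J k))) * w (\<gamma> k (Inf (J k)))) else 0)" if "k < m" for k
        using eq[OF that p ends'[OF _ that]] by (simp add: mult.assoc)
      \<comment> \<open>The continuation factor joins \<open>w\<close> in a new weight, against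
        which the boundary at the base point vanishes.\<close>
      show "(\<Sum>k<m. c k * ((if bdd_above (J k) then \<Psi> p k (Sup (J k)) * w (\<gamma> k (Sup (J k))) else 0) -
        (if bdd_below (J k) then \<Psi> p k (Inf (J k)) * w (\<gamma> k (Inf (J k))) else 0))) = 0"
        by (rule trans[OF sum.cong[OF refl] twisted_boundary_weighted[OF bdry,
              where w = "\<lambda>t. branch_factor ?p0 p t * w t"]])
          (simp only: lessThan_iff above below)
    qed
    show ?thesis
      unfolding Let_def
      by (intro conjI allI impI ballI pulled_back_form_integrable I_jointly_holomorphic
          partial_z_off_diagonal[of "(z, l)" for z l, unfolded fst_conv snd_conv]
          partial_z_diagonal[of "(z, l)" for z l, unfolded fst_conv snd_conv]
          partial_lambda[of "(z, l)" for z l, unfolded fst_conv snd_conv])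
  qed
  ultimately show ?thesis
    using U by (intro exI[of _ U]) blast
qed

end
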